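(* Let $A$ be a Prüfer $v$-multiplication domain with quotient field $F\neq A$. Then: (i) $t\text{-}\mathrm{Max}\,A$ is Noetherian in the Zariski topology if and only if each nonempty collection $X \neq \{F\}$ of pairwise incomparable (under inclusion) essential valuation overrings of $A$ is a strongly irredundant representation of the ring $\bigcap_{V \in X} V$. (ii) $t\text{-}\mathrm{Spec}\,A$ is Noetherian in the Zariski topology if and only if each nonempty collection $X\neq \{F\}$ of pairwise incomparable essential valuation overrings of $A$ is a tightly irredundant representation of the ring $\bigcap_{V \in X} V$.
   Context: For an ideal $I$ of a domain $A$ with quotient field $F$, $I_v = (A :_F (A :_F I))$ with $(A:_F I) = \{q \in F : qI \subseteq A\}$, and $I_t = \sum_J J_v$, where $J$ ranges over the finitely generated ideals of $A$ contained in $I$. $I$ is a $t$-ideal if $I = I_t$. A $t$-maximal ideal is an ideal maximal among proper $t$-ideals (such ideals are prime); $t\text{-}\mathrm{Max}\,A$ is the set of $t$-maximal ideals, and $t\text{-}\mathrm{Spec}\,A$ is the set of prime ideals that are $t$-ideals; both carry the subspace topology from $\mathrm{Spec}\,A$ with the Zariski topology. $A$ is a Prüfer $v$-multiplication domain (P$v$MD) if every nonzero finitely generated ideal $I$ of $A$ is $t$-invertible, i.e. $(I(A:_F I))_t = A$; equivalently, $A_M$ is a valuation domain for each $M \in t\text{-}\mathrm{Max}\,A$. A space is Noetherian if its open sets satisfy the ascending chain condition. A valuation overring of $A$ is a valuation ring $V$ with $A \subseteq V \subseteq F$; it is essential if $V = A_P$ for some prime ideal $P$ of $A$. For a ring $B$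 with $A \subseteq B \subsetneq F$, a representation of $B$ is a set $Y$ of valuation rings of $F$ containing $B$ with $B = \bigcap_{V \in Y} V$ (an empty intersection is $F$). A member $V$ of $Y$ is irredundant in $Y$ if $Y\setminus\{V\}$ is not a representation of $B$; it is strongly irredundant in $Y$ if it is irredundant and there is no valuation ring $W$ of $F$ with $V \subsetneq W$ such that $(Y \setminus \{V\}) \cup \{W\}$ is a representation of $B$; it is tightly irredundant in $Y$ if $(Y \cup \{W : W \text{ a valuation ring of } F,\ V \subseteq W\}) \setminus \{V\}$ is not a representation of $B$. A representation is strongly (resp. tightly) irredundant if each of its members is. *)

theory Defs
  imports "HOL-Algebra.Algebra" "HOL-Analysis.Abstract_Topology"
begin

text \<open>
  Throughout, a domain \<open>A\<close> is a subring of its quotient field \<open>F\<close>, so that \<open>A\<close> is a set of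
  elements of \<open>F\<close>; as a ring in its own right it is \<open>subring_of F A\<close>.
\<close>

abbreviation subring_of :: "('a, 'b) ring_scheme \<Rightarrow> 'a set \<Rightarrow> ('a, 'b) ring_scheme" where
  "subring_of F A \<equiv> F\<lparr>carrier := A\<rparr>"

definition quotient_field :: "('a, 'b) ring_scheme \<Rightarrow> 'a set \<Rightarrow> bool" where
  "quotient_field F A \<longleftrightarrow> field F \<and> subring A F \<and>
     (\<forall>x\<in>carrier F. \<exists>a\<in>A. \<exists>b\<in>A - {\<zero>\<^bsub>F\<^esub>}. x = a \<otimes>\<^bsub>F\<^esub> inv\<^bsub>F\<^esub> b)"


section \<open>The v- and t-operations\<close>

definition colon :: "('a, 'b) ring_scheme \<Rightarrow> 'a set \<Rightarrow> 'a set \<Rightarrow> 'a set" where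
  "colon F A I = {q \<in> carrier F. \<forall>x\<in>I. q \<otimes>\<^bsub>F\<^esub> x \<in> A}"

definition v_closure :: "('a, 'b) ring_scheme \<Rightarrow> 'a set \<Rightarrow> 'a set \<Rightarrow> 'a set" where
  "v_closure F A I = colon F A (colon F A I)"

definition fg_ideal :: "'a set \<Rightarrow> ('a, 'b) ring_scheme \<Rightarrow> bool" where
  "fg_ideal J R \<longleftrightarrow> (\<exists>S. finite S \<and> S \<subseteq> carrier R \<and> J = Idl\<^bsub>R\<^esub> S)"

text \<open>The sum of the ideals \<open>J\<^sub>v\<close> is the ideal generated by their union.\<close>

definition t_closure :: "('a, 'b) ring_scheme \<Rightarrow> 'a set \<Rightarrow> 'a set \<Rightarrow> 'a set" where
  "t_closure F A I =
     Idl\<^bsub>subring_of F A\<^esub> (\<Union>{v_closure F A J | J. fg_ideal J (subring_of F A) \<and> J \<subseteq> I})"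

definition t_ideal :: "('a, 'b) ring_scheme \<Rightarrow> 'a set \<Rightarrow> 'a set \<Rightarrow> bool" where
  "t_ideal F A I \<longleftrightarrow> ideal I (subring_of F A) \<and> t_closure F A I = I"

definition t_Max :: "('a, 'b) ring_scheme \<Rightarrow> 'a set \<Rightarrow> 'a set set" where
  "t_Max F A = {M. t_ideal F A M \<and> M \<noteq> A \<and>
     (\<forall>I. t_ideal F A I \<and> I \<noteq> A \<and> M \<subseteq> I \<longrightarrow> I = M)}"

definition t_Spec :: "('a, 'b) ring_scheme \<Rightarrow> 'a set \<Rightarrow> 'a set set" where
  "t_Spec F A = {P. primeideal P (subring_of F A) \<and> t_ideal F A P}"

definition t_invertible :: "('a, 'b) ring_scheme \<Rightarrow> 'a set \<Rightarrow> 'a set \<Rightarrow> bool" where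
  "t_invertible F A I \<longleftrightarrow> t_closure F A (ideal_prod F I (colon F A I)) = A"

definition PvMD :: "('a, 'b) ring_scheme \<Rightarrow> 'a set \<Rightarrow> bool" where
  "PvMD F A \<longleftrightarrow> quotient_field F A \<and>
     (\<forall>I. fg_ideal I (subring_of F A) \<and> I \<noteq> {\<zero>\<^bsub>F\<^esub>} \<longrightarrow> t_invertible F A I)"


section \<open>The Zariski topology\<close>

definition prime_spectrum :: "('a, 'b) ring_scheme \<Rightarrow> 'a set set" where
  "prime_spectrum R = {P. primeideal P R}"

definition zariski_topology :: "('a, 'b) ring_scheme \<Rightarrow> 'a set topology" where
  "zariski_topology R =
     topology (\<lambda>U. \<exists>S \<subseteq> carrier R. U = {P \<in> prime_spectrum R. \<not> S \<subseteq> P})"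

lemma istopology_zariski:
  "istopology (\<lambda>U. \<exists>S \<subseteq> carrier R. U = {P \<in> prime_spectrum R. \<not> S \<subseteq> P})"
  (is "istopology ?Z")
  unfolding istopology_def
proof (intro conjI allI impI)
  fix U V assume "?Z U" "?Z V"
  then obtain S T where S: "S \<subseteq> carrier R" "U = {P \<in> prime_spectrum R. \<not> S \<subseteq> P}"
    and T: "T \<subseteq> carrier R" "V = {P \<in> prime_spectrum R. \<not> T \<subseteq> P}" by blast
  let ?ST = "{s \<otimes>\<^bsub>R\<^esub> t | s t. s \<in> S \<and> t \<in> T}"
  have carr: "?ST \<subseteq> carrier R \<or> prime_spectrum R = {}"
  proof (cases "prime_spectrum R = {}")
    case False
    then obtain P where "primeideal P R" by (auto simp: prime_spectrum_def)
    then interpret primeideal P R .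
    show ?thesis using S T by auto
  qed auto
  have "\<not> ?ST \<subseteq> P \<longleftrightarrow> \<not> S \<subseteq> P \<and> \<not> T \<subseteq> P" if "P \<in> prime_spectrum R" for P
  proof -
    interpret primeideal P R using that by (simp add: prime_spectrum_def)
    have "s \<otimes>\<^bsub>R\<^esub> t \<in> P \<longleftrightarrow> s \<in> P \<or> t \<in> P" if "s \<in> S" "t \<in> T" for s t
      using that S T I_prime I_l_closed I_r_closed by blast
    then show ?thesis by blast
  qed
  then have UV: "U \<inter> V = {P \<in> prime_spectrum R. \<not> ?ST \<subseteq> P}" using S T by blast
  from carr show "?Z (U \<inter> V)"
  proof
    assume "?ST \<subseteq> carrier R"
    with UV show ?thesis by blast
  next
    assume "prime_spectrum R = {}"
    with UV have "U \<inter> V = {P \<in> prime_spectrum R. \<not> {} \<subseteq> P}" by simp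
    then show ?thesis by blast
  qed
next
  fix K assume "\<forall>U\<in>K. ?Z U"
  then obtain f where f: "\<And>U. U \<in> K \<Longrightarrow> f U \<subseteq> carrier R \<and> U = {P \<in> prime_spectrum R. \<not> f U \<subseteq> P}"
    by metis
  have "\<Union>K = {P \<in> prime_spectrum R. \<not> \<Union>(f ` K) \<subseteq> P}"
    using f by blast
  moreover have "\<Union>(f ` K) \<subseteq> carrier R" using f by blast
  ultimately show "?Z (\<Union>K)" by blast
qed

lemma openin_zariski:
  "openin (zariski_topology R) U \<longleftrightarrow>
     (\<exists>S \<subseteq> carrier R. U = {P \<in> prime_spectrum R. \<not> S \<subseteq> P})"
  unfolding zariski_topology_def topology_inverse'[OF istopology_zariski] ..

definition noetherian_space :: "'a topology \<Rightarrow> bool" where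
  "noetherian_space T \<longleftrightarrow>
     (\<forall>U :: nat \<Rightarrow> 'a set. (\<forall>n. openin T (U n) \<and> U n \<subseteq> U (Suc n)) \<longrightarrow>
        (\<exists>N. \<forall>n\<ge>N. U n = U N))"


section \<open>Valuation rings and representations\<close>

text \<open>The field \<open>F\<close> itself is a valuation ring of \<open>F\<close>.\<close>

definition valuation_ring :: "('a, 'b) ring_scheme \<Rightarrow> 'a set \<Rightarrow> bool" where
  "valuation_ring F V \<longleftrightarrow> subring V F \<and>
     (\<forall>x\<in>carrier F - {\<zero>\<^bsub>F\<^esub>}. x \<in> V \<or> inv\<^bsub>F\<^esub> x \<in> V)"

definition localization_at :: "('a, 'b) ring_scheme \<Rightarrow> 'a set \<Rightarrow> 'a set \<Rightarrow> 'a set" where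
  "localization_at F A P = {a \<otimes>\<^bsub>F\<^esub> inv\<^bsub>F\<^esub> s | a s. a \<in> A \<and> s \<in> A - P}"

definition valuation_overring :: "('a, 'b) ring_scheme \<Rightarrow> 'a set \<Rightarrow> 'a set \<Rightarrow> bool" where
  "valuation_overring F A V \<longleftrightarrow> valuation_ring F V \<and> A \<subseteq> V"

definition essential_valuation_overring ::
    "('a, 'b) ring_scheme \<Rightarrow> 'a set \<Rightarrow> 'a set \<Rightarrow> bool" where
  "essential_valuation_overring F A V \<longleftrightarrow> valuation_overring F A V \<and>
     (\<exists>P. primeideal P (subring_of F A) \<and> V = localization_at F A P)"

text \<open>Intersecting with \<open>carrier F\<close> makes the empty intersection equal to \<open>F\<close>.\<close>

definition representation :: "('a, 'b) ring_scheme \<Rightarrow> 'a set \<Rightarrow> 'a set \<Rightarrow> 'a set set \<Rightarrow> bool" where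
  "representation F A B Y \<longleftrightarrow>
     subring B F \<and> A \<subseteq> B \<and> B \<subset> carrier F \<and>
     (\<forall>V\<in>Y. valuation_ring F V \<and> B \<subseteq> V) \<and> B = carrier F \<inter> \<Inter>Y"

definition irredundant ::
    "('a, 'b) ring_scheme \<Rightarrow> 'a set \<Rightarrow> 'a set \<Rightarrow> 'a set set \<Rightarrow> 'a set \<Rightarrow> bool" where
  "irredundant F A B Y V \<longleftrightarrow> \<not> representation F A B (Y - {V})"

definition strongly_irredundant ::
    "('a, 'b) ring_scheme \<Rightarrow> 'a set \<Rightarrow> 'a set \<Rightarrow> 'a set set \<Rightarrow> 'a set \<Rightarrow> bool" where
  "strongly_irredundant F A B Y V \<longleftrightarrow> irredundant F A B Y V \<and>
     \<not> (\<exists>W. valuation_ring F W \<and> V \<subset> W \<and> representation F A B ((Y - {V}) \<union> {W}))"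

definition tightly_irredundant ::
    "('a, 'b) ring_scheme \<Rightarrow> 'a set \<Rightarrow> 'a set \<Rightarrow> 'a set set \<Rightarrow> 'a set \<Rightarrow> bool" where
  "tightly_irredundant F A B Y V \<longleftrightarrow>
     \<not> representation F A B ((Y \<union> {W. valuation_ring F W \<and> V \<subseteq> W}) - {V})"

definition strongly_irredundant_representation ::
    "('a, 'b) ring_scheme \<Rightarrow> 'a set \<Rightarrow> 'a set \<Rightarrow> 'a set set \<Rightarrow> bool" where
  "strongly_irredundant_representation F A B Y \<longleftrightarrow>
     representation F A B Y \<and> (\<forall>V\<in>Y. strongly_irredundant F A B Y V)"

definition tightly_irredundant_representation ::
    "('a, 'b) ring_scheme \<Rightarrow> 'a set \<Rightarrow> 'a set \<Rightarrow> 'a set set \<Rightarrow> bool" where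
  "tightly_irredundant_representation F A B Y \<longleftrightarrow>
     representation F A B Y \<and> (\<forall>V\<in>Y. tightly_irredundant F A B Y V)"

end

theory Submission
  imports Defs "HOL-Library.Ramsey"
begin

text \<open>
  In a P\<open>v\<close>MD the essential valuation overrings are exactly the rings \<open>A\<^sub>P\<close> with \<open>P\<close> a \<open>t\<close>-prime, and
  by \<open>t\<close>-invertibility membership of a given \<open>x\<close> in \<open>A\<^sub>P\<close> is decided by a finite set \<open>S \<subseteq> A\<close>:
  \<open>x \<in> A\<^sub>P\<close> iff \<open>S\<close> is not contained in \<open>P\<close>.

  If the relevant space is Noetherian, then \<open>P\<close> is, within that space, cut out by a finite
  \<open>S \<subseteq> P\<close>. No \<open>t\<close>-prime incomparable to \<open>P\<close> contains \<open>S\<close>, and the \<open>t\<close>-inverse of the ideal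
  generated by \<open>S\<close> (and, for a given larger valuation ring \<open>W\<close>, an element of \<open>P\<close> that is a unit of \<open>W\<close>)
  supplies an element outside \<open>A\<^sub>P\<close> lying in all the other rings.

  If the space is not Noetherian, it contains points \<open>P\<^sub>n\<close> and there are elements \<open>f\<^sub>n\<close> with \<open>f\<^sub>n\<close> outside
  \<open>P\<^sub>n\<close> but in \<open>P\<^sub>m\<close> for all \<open>m > n\<close>. A limit \<open>Q\<close> of the \<open>P\<^sub>n\<close> is a \<open>t\<close>-prime whose localization contains
  the intersection of the rings \<open>A\<close> localized at \<open>P\<^sub>n\<close>. When the \<open>P\<^sub>n\<close> are pairwise incomparable, at most one
  of them lies in \<open>Q\<close>, and \<open>A\<^sub>Q\<close> together with the others is a redundant collection; when they form a
  chain, \<open>{A\<^sub>Q}\<close> alone is not tightly irredundant.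
\<close>

section \<open>Sequences in non-Noetherian subspaces of a spectrum\<close>

lemma openin_subtopology_zariski:
  assumes "T \<subseteq> prime_spectrum R"
  shows "openin (subtopology (zariski_topology R) T) U \<longleftrightarrow>
    (\<exists>S\<subseteq>carrier R. U = {P \<in> T. \<not> S \<subseteq> P})"
proof -
  let ?D = "\<lambda>S. {P \<in> prime_spectrum R. \<not> S \<subseteq> P}"
  have D: "?D S \<inter> T = {P \<in> T. \<not> S \<subseteq> P}" for S
    using assms by blast
  have "(\<exists>V. (\<exists>S\<subseteq>carrier R. V = ?D S) \<and> U = V \<inter> T) \<longleftrightarrow> (\<exists>S\<subseteq>carrier R. U = ?D S \<inter> T)"
    by blast
  then show ?thesis unfolding openin_subtopology openin_zariski D .
qed

text \<open>Each strict step of an ascending chain of open sets gains a point \<open>P n\<close>,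
  and an element \<open>f n\<close> witnesses the gain; conversely, the open sets cut out by the
  first \<open>n\<close> elements grow at every step.\<close>

lemma noetherian_zariski_subspace_iff:
  assumes T: "T \<subseteq> prime_spectrum R"
  shows "noetherian_space (subtopology (zariski_topology R) T) \<longleftrightarrow>
    \<not> (\<exists>P f. (\<forall>n::nat. P n \<in> T \<and> f n \<in> carrier R - P n) \<and> (\<forall>n m. n < m \<longrightarrow> f n \<in> P m))"
proof
  assume noeth: "noetherian_space (subtopology (zariski_topology R) T)"
  show "\<not> (\<exists>P f. (\<forall>n::nat. P n \<in> T \<and> f n \<in> carrier R - P n) \<and> (\<forall>n m. n < m \<longrightarrow> f n \<in> P m))"
  proof
    assume "\<exists>P f. (\<forall>n::nat. P n \<in> T \<and> f n \<in> carrier R - P n) \<and> (\<forall>n m. n < m \<longrightarrow> f n \<in> P m)"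
    then obtain P f where P: "\<forall>n :: nat. P n \<in> T \<and> f n \<in> carrier R - P n"
      and f: "\<forall>n m. n < m \<longrightarrow> f n \<in> P m" by blast
    define U where "U n = {Q \<in> T. \<not> f ` {..<n} \<subseteq> Q}" for n :: nat
    have "openin (subtopology (zariski_topology R) T) (U n)" for n
      unfolding openin_subtopology_zariski[OF T] U_def using P by blast
    moreover have "U n \<subseteq> U (Suc n)" for n unfolding U_def by (auto simp: lessThan_Suc)
    ultimately obtain N where N: "\<And>n. n \<ge> N \<Longrightarrow> U n = U N"
      using noeth unfolding noetherian_space_def by meson
    have "P N \<in> U (Suc N)" using P by (auto simp: U_def)
    moreover have "P N \<notin> U N" using f by (auto simp: U_def)
    ultimately show False using N[of "Suc N"] by simp
  qed
next
  assume no: "\<not> (\<exists>P f. (\<forall>n::nat. P n \<in> T \<and> f n \<in> carrier R - P n) \<and> (\<forall>n m. n < m \<longrightarrow> f n \<in> P m))"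
  show "noetherian_space (subtopology (zariski_topology R) T)"
    unfolding noetherian_space_def
  proof (intro allI impI; rule ccontr)
    fix U :: "nat \<Rightarrow> _" assume U: "\<forall>n. openin (subtopology (zariski_topology R) T) (U n) \<and> U n \<subseteq> U (Suc n)"
      and not: "\<not> (\<exists>N. \<forall>n\<ge>N. U n = U N)"
    have mono: "U m \<subseteq> U n" if "m \<le> n" for m n
      by (rule lift_Suc_mono_le[of U, OF _ that]) (use U in blast)
    obtain S where S: "\<And>n. S n \<subseteq> carrier R" "\<And>n. U n = {P \<in> T. \<not> S n \<subseteq> P}"
      using U unfolding openin_subtopology_zariski[OF T] by metis
    have "\<forall>N. \<exists>n. N \<le> n \<and> U n \<noteq> U N" using not by blast
    then obtain g where g: "\<And>N. N \<le> g N" "\<And>N. U (g N) \<noteq> U N" by metis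
    \<comment> \<open>Iterating \<open>g\<close> thins the chain to indices between which it grows
      strictly.\<close>
    define r where "r k = (g ^^ k) 0" for k
    have r_Suc: "r (Suc k) = g (r k)" for k by (simp add: r_def)
    have r_mono: "r k \<le> r l" if "k \<le> l" for k l
      by (rule lift_Suc_mono_le[OF _ that]) (simp add: r_Suc g)
    have "\<exists>P. P \<in> U (r (Suc k)) \<and> P \<notin> U (r k)" for k
      using g[of "r k"] mono[of "r k" "g (r k)"] unfolding r_Suc by blast
    then obtain P where P: "\<And>k. P k \<in> U (r (Suc k))" "\<And>k. P k \<notin> U (r k)" by metis
    have "\<exists>x. x \<in> S (r (Suc k)) \<and> x \<notin> P k" for k using P(1)[of k] S(2) by blast
    then obtain f where f: "\<And>k. f k \<in> S (r (Suc k))" "\<And>k. f k \<notin> P k" by metis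
    have PT: "P k \<in> T" for k using P(1)[of k] S(2) by blast
    have "f k \<in> P l" if "k < l" for k l
    proof -
      have "P l \<notin> U (r (Suc k))" using mono[OF r_mono[of "Suc k" l]] that P(2)[of l] by auto
      then show ?thesis using S(2) PT f(1) by blast
    qed
    moreover have "f k \<in> carrier R - P k" for k using f S(1) by blast
    ultimately show False using no PT by blast
  qed
qed

text \<open>If every finite subset failed, adjoining again and again an element of \<open>K\<close>
  missed by a point containing the set so far would build a sequence excluded by the Noetherian
  property. With a \<open>t\<close>-prime for \<open>K\<close>, the points containing it are
  described by finitely many of its elements.\<close>

lemma noetherian_zariski_finite_subset:
  assumes T: "T \<subseteq> prime_spectrum R"
    and noeth: "noetherian_space (subtopology (zariski_topology R) T)"
    and K: "K \<subseteq> carrier R"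
  obtains S where "finite S" "S \<subseteq> K" "\<And>P. P \<in> T \<Longrightarrow> S \<subseteq> P \<Longrightarrow> K \<subseteq> P"
proof (rule ccontr)
  assume not: "\<not> thesis"
  have "\<forall>S. \<exists>P x. finite S \<and> S \<subseteq> K \<longrightarrow> P \<in> T \<and> S \<subseteq> P \<and> x \<in> K \<and> x \<notin> P"
    using that not by blast
  then obtain P x where Px: "\<And>S. finite S \<Longrightarrow> S \<subseteq> K \<Longrightarrow> P S \<in> T \<and> S \<subseteq> P S \<and> x S \<in> K \<and> x S \<notin> P S"
    by metis
  define S where "S n = ((\<lambda>S. insert (x S) S) ^^ n) {}" for n
  have S_Suc: "S (Suc n) = insert (x (S n)) (S n)" for n by (simp add: S_def)
  have S: "finite (S n) \<and> S n \<subseteq> K" for n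
  proof (induction n)
    case 0
    then show ?case by (simp add: S_def)
  next
    case (Suc n)
    then show ?case using Px unfolding S_Suc by simp
  qed
  have S_mono: "S m \<subseteq> S n" if "m \<le> n" for m n
    by (rule lift_Suc_mono_le[OF _ that]) (auto simp: S_Suc)
  have PxS: "P (S n) \<in> T" "S n \<subseteq> P (S n)" "x (S n) \<in> K" "x (S n) \<notin> P (S n)" for n
    using Px[of "S n"] S[of n] by simp_all
  have "x (S n) \<in> P (S m)" if "n < m" for n m
    using S_mono[of "Suc n" m] that PxS(2)[of m] by (auto simp: S_Suc)
  then have "\<exists>P f. (\<forall>n::nat. P n \<in> T \<and> f n \<in> carrier R - P n) \<and> (\<forall>n m. n < m \<longrightarrow> f n \<in> P m)"
    using PxS K by (intro exI[of _ "\<lambda>n. P (S n)"] exI[of _ "\<lambda>n. x (S n)"]) auto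
  then show False using noeth unfolding noetherian_zariski_subspace_iff[OF T] by simp
qed

section \<open>Ideals, localizations and the \<open>t\<close>-operation\<close>

locale fraction_field =
  fixes F :: "('a, 'b) ring_scheme" (structure) and A :: "'a set"
  assumes quotient_field: "quotient_field F A"
    and proper: "carrier F \<noteq> A"

sublocale fraction_field \<subseteq> field F
  using quotient_field by (simp add: quotient_field_def)

context fraction_field
begin

abbreviation R where "R \<equiv> subring_of F A"

lemma subring_A: "subring A F"
  using quotient_field by (simp add: quotient_field_def)

lemma A_carr [simp]: "a \<in> A \<Longrightarrow> a \<in> carrier F"
  using subringE(1)[OF subring_A] by blast

lemma A_closed [simp]:
  "\<zero> \<in> A" "\<one> \<in> A"
  "a \<in> A \<Longrightarrow> b \<in> A \<Longrightarrow> a \<oplus> b \<in> A"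
  "a \<in> A \<Longrightarrow> b \<in> A \<Longrightarrow> a \<otimes> b \<in> A"
  "a \<in> A \<Longrightarrow> \<ominus> a \<in> A"
  using subringE[OF subring_A] by auto

lemma ring_R: "ring R" and cring_R: "cring R"
  using subring_is_ring[OF subring_A] subring_is_domain[OF subring_A]
  by (auto simp: domain_def)

lemma inverse_simps [simp]:
  assumes "x \<in> carrier F" "x \<noteq> \<zero>"
  shows "inv x \<in> carrier F" "x \<otimes> inv x = \<one>" "inv x \<otimes> x = \<one>" "inv x \<noteq> \<zero>" "inv (inv x) = x"
    "y \<in> carrier F \<Longrightarrow> x \<otimes> (inv x \<otimes> y) = y" "y \<in> carrier F \<Longrightarrow> inv x \<otimes> (x \<otimes> y) = y"
proof -
  have x: "x \<in> Units F" using assms field_Units by blast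
  then show inv: "inv x \<in> carrier F" "x \<otimes> inv x = \<one>" "inv x \<otimes> x = \<one>" "inv (inv x) = x" by auto
  then show "inv x \<noteq> \<zero>" using assms by (metis r_null zero_not_one)
  show "x \<otimes> (inv x \<otimes> y) = y" "inv x \<otimes> (x \<otimes> y) = y" if "y \<in> carrier F"
    using m_assoc[of x "inv x" y, symmetric] m_assoc[of "inv x" x y, symmetric] inv(1-3) assms(1) that
    by simp_all
qed

lemma ideal_iff:
  "ideal I R \<longleftrightarrow> I \<subseteq> A \<and> \<zero> \<in> I \<and> (\<forall>x\<in>I. \<forall>y\<in>I. x \<oplus> y \<in> I) \<and> (\<forall>a\<in>A. \<forall>x\<in>I. a \<otimes> x \<in> I)"
    (is "_ \<longleftrightarrow> ?r")
proof
  assume I: "ideal I R"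
  then have add: "additive_subgroup I R" by (rule ideal.axioms)
  show ?r
    using ideal.Icarr[OF I] ideal.I_l_closed[OF I] additive_subgroup.a_closed[OF add]
      additive_subgroup.zero_closed[OF add] by auto
next
  assume r: ?r
  have neg: "\<ominus>\<^bsub>R\<^esub> x \<in> I" if x: "x \<in> I" for x
  proof -
    have "\<ominus>\<^bsub>R\<^esub> x = (\<ominus>\<^bsub>R\<^esub> \<one>) \<otimes> x"
      using ring.l_minus[OF ring_R, of \<one> x] r x by (auto simp: subset_iff)
    moreover have "\<ominus>\<^bsub>R\<^esub> \<one> \<in> A" using abelian_group.a_inv_closed[OF ring.is_abelian_group[OF ring_R], of \<one>] by simp
    ultimately show ?thesis using r x by simp
  qed
  show "ideal I R"
  proof (rule idealI[OF ring_R])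
    show "subgroup I (add_monoid R)"
      by (rule group.subgroupI) (use r neg abelian_group.a_group[OF ring.is_abelian_group[OF ring_R]] in \<open>auto simp: a_inv_def\<close>)
    show "x \<otimes>\<^bsub>R\<^esub> a \<in> I" if "a \<in> I" "x \<in> carrier R" for a x
      using r that by auto
    show "a \<otimes>\<^bsub>R\<^esub> x \<in> I" if "a \<in> I" "x \<in> carrier R" for a x
      using r that m_comm[of a x] by (auto simp: subset_iff)
  qed
qed

lemma primeideal_iff:
  "primeideal P R \<longleftrightarrow> ideal P R \<and> \<one> \<notin> P \<and> (\<forall>a\<in>A. \<forall>b\<in>A. a \<otimes> b \<in> P \<longrightarrow> a \<in> P \<or> b \<in> P)"
    (is "_ \<longleftrightarrow> ?r")
proof
  assume P: "primeideal P R"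
  then have I: "ideal P R" by (rule primeideal.axioms)
  then have "\<one> \<notin> P" using ideal.one_imp_carrier[OF I] primeideal.I_notcarr[OF P] by auto
  then show ?r using primeideal.I_prime[OF P] I by simp
next
  assume ?r
  then show "primeideal P R" by (intro primeidealI[OF _ cring_R]) auto
qed

lemma idealD:
  assumes "ideal P R"
  shows "x \<in> P \<Longrightarrow> x \<in> A" "\<zero> \<in> P" "x \<in> P \<Longrightarrow> y \<in> P \<Longrightarrow> x \<oplus> y \<in> P"
    "a \<in> A \<Longrightarrow> x \<in> P \<Longrightarrow> a \<otimes> x \<in> P" "a \<in> A \<Longrightarrow> x \<in> P \<Longrightarrow> x \<otimes> a \<in> P"
  using assms m_comm[of x a] unfolding ideal_iff by (auto simp: subset_iff)

lemma primeD:
  assumes "primeideal P R"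
  shows "ideal P R" "\<one> \<notin> P" "a \<in> A \<Longrightarrow> b \<in> A \<Longrightarrow> a \<otimes> b \<in> P \<Longrightarrow> a \<in> P \<or> b \<in> P"
  using assms unfolding primeideal_iff by auto

section \<open>Localizations at prime ideals\<close>

lemma prime_complement_mult:
  assumes "primeideal P R" "s \<in> A - P" "t \<in> A - P"
  shows "s \<otimes> t \<in> A - P"
  using assms primeD(3)[OF assms(1)] by auto

text \<open>Clearing denominators avoids the choice of a fraction; a multiplier outside
  \<open>P\<close> is nonzero because \<open>P\<close> contains zero.\<close>

lemma in_localization_iff:
  assumes P: "primeideal P R"
  shows "x \<in> localization_at F A P \<longleftrightarrow> x \<in> carrier F \<and> (\<exists>s\<in>A - P. s \<otimes> x \<in> A)"
proof
  assume "x \<in> localization_at F A P"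
  then obtain a s where as: "a \<in> A" "s \<in> A - P" "x = a \<otimes> inv s"
    unfolding localization_at_def by blast
  then have "s \<noteq> \<zero>" using idealD(2)[OF primeD(1)[OF P]] by auto
  with as have "x \<in> carrier F" "s \<otimes> x = a" by (auto simp: m_lcomm[of s a "inv s"])
  then show "x \<in> carrier F \<and> (\<exists>s\<in>A - P. s \<otimes> x \<in> A)"
    using as by (intro conjI bexI[of _ s]) auto
next
  assume "x \<in> carrier F \<and> (\<exists>s\<in>A - P. s \<otimes> x \<in> A)"
  then obtain s where s: "x \<in> carrier F" "s \<in> A - P" "s \<otimes> x \<in> A" by blast
  then have "s \<noteq> \<zero>" using idealD(2)[OF primeD(1)[OF P]] by auto
  with s have "x = (s \<otimes> x) \<otimes> inv s" by (simp add: m_comm[of "s \<otimes> x" "inv s"])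
  with s show "x \<in> localization_at F A P" unfolding localization_at_def by blast
qed

lemma in_localizationI:
  assumes "primeideal P R" "s \<in> A" "s \<notin> P" "x \<in> carrier F" "s \<otimes> x \<in> A"
  shows "x \<in> localization_at F A P"
  using assms in_localization_iff by blast

lemma subset_localization:
  assumes "primeideal P R"
  shows "A \<subseteq> localization_at F A P"
  using primeD(2)[OF assms] by (auto intro: in_localizationI[OF assms, of \<one>])

text \<open>It recovers \<open>P\<close> from its localization, as zero together with the elements
  of \<open>A\<close> whose inverse is not there.\<close>

lemma inv_in_localization:
  assumes P: "primeideal P R" and s: "s \<in> A" "s \<noteq> \<zero>"
  shows "inv s \<in> localization_at F A P \<longleftrightarrow> s \<notin> P"
proof
  assume "inv s \<in> localization_at F A P"
  then obtain u where u: "u \<in> A - P" "u \<otimes> inv s \<in> A"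
    using in_localization_iff[OF P] by blast
  have "u = s \<otimes> (u \<otimes> inv s)" using u s by (simp add: m_lcomm[of s u])
  then show "s \<notin> P" using u idealD(5)[OF primeD(1)[OF P], of "u \<otimes> inv s" s] by auto
next
  assume "s \<notin> P"
  then show "inv s \<in> localization_at F A P"
    using s by (auto intro!: in_localizationI[OF P, of s])
qed

lemma subring_localization:
  assumes P: "primeideal P R"
  shows "subring (localization_at F A P) F"
proof (rule subringI)
  show "localization_at F A P \<subseteq> carrier F" "\<one> \<in> localization_at F A P"
    using in_localization_iff[OF P] subset_localization[OF P] A_closed(2) by blast+
  fix h assume h: "h \<in> localization_at F A P"
  then obtain s where s: "h \<in> carrier F" "s \<in> A - P" "s \<otimes> h \<in> A"
    using in_localization_iff[OF P] by blast
  then show "\<ominus> h \<in> localization_at F A P"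
    by (auto simp: r_minus intro!: in_localizationI[OF P, of s])
  fix k assume k: "k \<in> localization_at F A P"
  then obtain t where t: "k \<in> carrier F" "t \<in> A - P" "t \<otimes> k \<in> A"
    using in_localization_iff[OF P] by blast
  have st: "s \<otimes> t \<in> A - P" using s t prime_complement_mult[OF P] by blast
  have "(s \<otimes> t) \<otimes> (h \<otimes> k) = (s \<otimes> h) \<otimes> (t \<otimes> k)"
    using s t by (simp add: m_ac)
  then show "h \<otimes> k \<in> localization_at F A P"
    using s t st by (auto intro!: in_localizationI[OF P, of "s \<otimes> t"])
  have "(s \<otimes> t) \<otimes> (h \<oplus> k) = t \<otimes> (s \<otimes> h) \<oplus> s \<otimes> (t \<otimes> k)"
    using s t by (simp add: m_ac r_distr)
  moreover have "t \<otimes> (s \<otimes> h) \<oplus> s \<otimes> (t \<otimes> k) \<in> A" using s t by simp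
  ultimately show "h \<oplus> k \<in> localization_at F A P"
    using s t st by (auto intro!: in_localizationI[OF P, of "s \<otimes> t"])
qed

lemma localization_subset_iff:
  assumes P: "primeideal P R" and Q: "primeideal Q R"
  shows "localization_at F A P \<subseteq> localization_at F A Q \<longleftrightarrow> Q \<subseteq> P"
proof
  assume "Q \<subseteq> P"
  then show "localization_at F A P \<subseteq> localization_at F A Q"
    unfolding localization_at_def by blast
next
  assume sub: "localization_at F A P \<subseteq> localization_at F A Q"
  show "Q \<subseteq> P"
  proof
    fix q assume q: "q \<in> Q"
    then have "q \<in> A" using idealD(1)[OF primeD(1)[OF Q]] by blast
    then show "q \<in> P"
      using sub q inv_in_localization[OF P, of q] inv_in_localization[OF Q, of q]
        idealD(2)[OF primeD(1)[OF P]] by blast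
  qed
qed

text \<open>A multiplier \<open>s\<close> outside \<open>P\<close> with \<open>s x\<close> in
  \<open>A\<close> gives \<open>s (p x) = p (s x)\<close> in \<open>P\<close>, and primeness removes
  \<open>s\<close>.\<close>

lemma prime_mult_localization:
  assumes P: "primeideal P R" and p: "p \<in> P" "x \<in> localization_at F A P" "p \<otimes> x \<in> A"
  shows "p \<otimes> x \<in> P"
proof -
  obtain s where s: "x \<in> carrier F" "s \<in> A - P" "s \<otimes> x \<in> A"
    using in_localization_iff[OF P] p by blast
  have pA: "p \<in> A" using p idealD(1)[OF primeD(1)[OF P]] by blast
  have "s \<otimes> (p \<otimes> x) = p \<otimes> (s \<otimes> x)" using s pA by (simp add: m_ac)
  also have "\<dots> \<in> P" using idealD(5)[OF primeD(1)[OF P]] s p by blast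
  finally show ?thesis using primeD(3)[OF P, of s "p \<otimes> x"] s p by blast
qed

text \<open>The primes inside \<open>M\<close> are those of the valuation ring
  \<open>A\<^sub>M\<close>, so they form a chain. Concretely, if \<open>a/b\<close> is in
  \<open>A\<^sub>M\<close> with \<open>b\<close> in \<open>I\<close>, clearing denominators by
  \<open>s\<close> outside \<open>M\<close> puts \<open>s a\<close> into \<open>I\<close>, hence
  \<open>a\<close> too.\<close>

lemma primes_below_valuation_comparable:
  assumes M: "primeideal M R" and V: "valuation_ring F (localization_at F A M)"
    and P: "primeideal P R" "P \<subseteq> M" and Q: "primeideal Q R" "Q \<subseteq> M"
  shows "P \<subseteq> Q \<or> Q \<subseteq> P"
proof (rule ccontr)
  assume "\<not> (P \<subseteq> Q \<or> Q \<subseteq> P)"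
  then obtain p q where pq: "p \<in> P" "p \<notin> Q" "q \<in> Q" "q \<notin> P" by blast
  have *: False if I: "primeideal I R" "I \<subseteq> M" and ab: "a \<in> A" "a \<notin> I" "b \<in> I" "b \<noteq> \<zero>"
    and loc: "a \<otimes> inv b \<in> localization_at F A M" for I a b
  proof -
    have bA: "b \<in> A" using ab idealD(1)[OF primeD(1)[OF I(1)]] by blast
    obtain s where s: "s \<in> A - M" "s \<otimes> (a \<otimes> inv b) \<in> A"
      using loc in_localization_iff[OF M] by blast
    have "s \<otimes> a = b \<otimes> (s \<otimes> (a \<otimes> inv b))" using s ab bA by (simp add: m_lcomm[of b s] m_lcomm[of b a])
    also have "\<dots> \<in> I" using idealD(5)[OF primeD(1)[OF I(1)]] ab s by blast
    finally show False using primeD(3)[OF I(1), of s a] s ab I by blast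
  qed
  have A: "p \<in> A" "q \<in> A" using pq idealD(1)[OF primeD(1)] P Q by blast+
  have nz: "p \<noteq> \<zero>" "q \<noteq> \<zero>" using pq idealD(2)[OF primeD(1)] P Q by blast+
  have "p \<otimes> inv q \<in> carrier F - {\<zero>}"
    using A nz by (auto simp: integral_iff)
  then have "p \<otimes> inv q \<in> localization_at F A M \<or> inv (p \<otimes> inv q) \<in> localization_at F A M"
    using V unfolding valuation_ring_def by blast
  moreover have "inv (p \<otimes> inv q) = q \<otimes> inv p"
    using A nz by (intro comm_inv_char) (auto simp: m_ac)
  ultimately show False using *[OF Q, of p q] *[OF P, of q p] A nz pq by auto
qed

section \<open>Colon sets, \<open>v\<close>-closures and \<open>t\<close>-ideals\<close>

lemma colon_iff: "q \<in> colon F A I \<longleftrightarrow> q \<in> carrier F \<and> (\<forall>x\<in>I. q \<otimes> x \<in> A)"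
  by (simp add: colon_def)

lemma v_closure_iff:
  "y \<in> v_closure F A S \<longleftrightarrow> y \<in> carrier F \<and> (\<forall>q\<in>carrier F. (\<forall>x\<in>S. q \<otimes> x \<in> A) \<longrightarrow> y \<otimes> q \<in> A)"
  by (auto simp: v_closure_def colon_iff)

lemma colon_antimono: "S \<subseteq> T \<Longrightarrow> colon F A T \<subseteq> colon F A S"
  unfolding colon_def by blast

lemma v_closure_mono: "S \<subseteq> T \<Longrightarrow> v_closure F A S \<subseteq> v_closure F A T"
  by (simp add: v_closure_def colon_antimono)

lemma v_closure_self: "S \<subseteq> A \<Longrightarrow> S \<subseteq> v_closure F A S"
  by (auto simp: v_closure_iff m_comm subset_iff)

lemma v_closure_subset: "S \<subseteq> A \<Longrightarrow> v_closure F A S \<subseteq> A"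
proof
  fix y assume S: "S \<subseteq> A" and "y \<in> v_closure F A S"
  moreover have "\<forall>x\<in>S. \<one> \<otimes> x \<in> A" using S by (auto simp: subset_iff)
  ultimately show "y \<in> A" by (metis v_closure_iff one_closed r_one)
qed

text \<open>The elements of \<open>A\<close> that \<open>q\<close> multiplies into \<open>A\<close>
  form an ideal, so \<open>q\<close> may be tested on generators. From here on finite sets stand in
  for finitely generated ideals.\<close>

lemma colon_Idl:
  assumes S: "S \<subseteq> A"
  shows "colon F A (Idl\<^bsub>R\<^esub> S) = colon F A S"
proof
  have *: "S \<subseteq> Idl\<^bsub>R\<^esub> S" using ring.genideal_self[OF ring_R] S by simp
  then show "colon F A (Idl\<^bsub>R\<^esub> S) \<subseteq> colon F A S" by (rule colon_antimono)
  show "colon F A S \<subseteq> colon F A (Idl\<^bsub>R\<^esub> S)"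
  proof
    fix q assume q: "q \<in> colon F A S"
    then have "ideal {x \<in> A. q \<otimes> x \<in> A} R"
      unfolding ideal_iff by (auto simp: colon_iff r_distr m_lcomm[of q])
    then have "Idl\<^bsub>R\<^esub> S \<subseteq> {x \<in> A. q \<otimes> x \<in> A}"
      by (rule ring.genideal_minimal[OF ring_R]) (use S q in \<open>auto simp: colon_iff\<close>)
    then show "q \<in> colon F A (Idl\<^bsub>R\<^esub> S)" using q by (auto simp: colon_iff)
  qed
qed

lemma v_closure_Idl: "S \<subseteq> A \<Longrightarrow> v_closure F A (Idl\<^bsub>R\<^esub> S) = v_closure F A S"
  by (simp add: v_closure_def colon_Idl)

lemma fg_ideal_iff: "fg_ideal J R \<longleftrightarrow> (\<exists>S. finite S \<and> S \<subseteq> A \<and> J = Idl\<^bsub>R\<^esub> S)"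
  by (simp add: fg_ideal_def)

text \<open>A \<open>v\<close>-closure depends only on generators, so the union in the
  \<open>t\<close>-closure may run over finite sets; once this union is inside the ideal
  \<open>I\<close>, so is the ideal it generates.\<close>

lemma t_ideal_iff:
  "t_ideal F A I \<longleftrightarrow> ideal I R \<and> (\<forall>S. finite S \<and> S \<subseteq> I \<longrightarrow> v_closure F A S \<subseteq> I)"
proof -
  let ?U = "\<Union>{v_closure F A J | J. fg_ideal J R \<and> J \<subseteq> I}"
  have "t_closure F A I = I \<longleftrightarrow> (\<forall>S. finite S \<and> S \<subseteq> I \<longrightarrow> v_closure F A S \<subseteq> I)" if I: "ideal I R"
  proof -
    have IA: "I \<subseteq> A" using idealD(1)[OF I] by blast
    have U: "?U = \<Union>{v_closure F A S | S. finite S \<and> S \<subseteq> I}" (is "_ = ?W")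
    proof
      show "?U \<subseteq> ?W"
      proof (rule Union_least, clarify)
        fix J y assume J: "fg_ideal J R" "J \<subseteq> I" and y: "y \<in> v_closure F A J"
        then obtain S where S: "finite S" "S \<subseteq> A" "J = Idl\<^bsub>R\<^esub> S" by (auto simp: fg_ideal_iff)
        then have "S \<subseteq> I" using ring.genideal_self[OF ring_R, of S] J by auto
        moreover have "y \<in> v_closure F A S" using S y v_closure_Idl by simp
        ultimately show "y \<in> ?W" using S(1) by blast
      qed
      show "?W \<subseteq> ?U"
      proof (rule Union_least, clarify)
        fix S y assume S: "finite S" "S \<subseteq> I" and y: "y \<in> v_closure F A S"
        then have SA: "S \<subseteq> A" using IA by blast
        have "fg_ideal (Idl\<^bsub>R\<^esub> S) R" "Idl\<^bsub>R\<^esub> S \<subseteq> I"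
          using S SA ring.genideal_minimal[OF ring_R I] by (auto simp: fg_ideal_iff)
        moreover have "y \<in> v_closure F A (Idl\<^bsub>R\<^esub> S)" using y v_closure_Idl[OF SA] by simp
        ultimately show "y \<in> ?U" by blast
      qed
    qed
    have UA: "?U \<subseteq> carrier R"
      unfolding U using v_closure_subset[THEN subsetD] IA by (intro Union_least subsetI) (simp, blast)
    have "I \<subseteq> ?U"
    proof
      fix x assume "x \<in> I"
      then have "x \<in> v_closure F A {x}" using v_closure_self[of "{x}"] IA by blast
      with \<open>x \<in> I\<close> show "x \<in> ?U" unfolding U by (intro UnionI[of "v_closure F A {x}"]) auto
    qed
    moreover have "?U \<subseteq> t_closure F A I"
      unfolding t_closure_def by (rule ring.genideal_self[OF ring_R UA])
    moreover have "t_closure F A I \<subseteq> I" if "?U \<subseteq> I"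
      unfolding t_closure_def by (rule ring.genideal_minimal[OF ring_R I that])
    ultimately have "t_closure F A I = I \<longleftrightarrow> ?U \<subseteq> I"
      using subset_antisym subset_trans by (intro iffI) simp_all
    moreover have "?U \<subseteq> I \<longleftrightarrow> (\<forall>S. finite S \<and> S \<subseteq> I \<longrightarrow> v_closure F A S \<subseteq> I)"
      unfolding U by blast
    ultimately show ?thesis by simp
  qed
  then show ?thesis unfolding t_ideal_def by blast
qed

lemma t_Spec_iff:
  "P \<in> t_Spec F A \<longleftrightarrow> primeideal P R \<and> (\<forall>S. finite S \<and> S \<subseteq> P \<longrightarrow> v_closure F A S \<subseteq> P)"
  unfolding t_Spec_def t_ideal_iff using primeD(1) by blast

lemma t_Spec_prime: "P \<in> t_Spec F A \<Longrightarrow> primeideal P R"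
  by (simp add: t_Spec_iff)

lemma t_SpecD:
  assumes "P \<in> t_Spec F A"
  shows "x \<in> P \<Longrightarrow> x \<in> A" "\<zero> \<in> P" "\<one> \<notin> P" "P \<noteq> A" "t_ideal F A P"
proof -
  note P = t_Spec_prime[OF assms]
  show "x \<in> P \<Longrightarrow> x \<in> A" "\<zero> \<in> P" using idealD(1,2)[OF primeD(1)[OF P]] by simp_all
  show one: "\<one> \<notin> P" by (rule primeD(2)[OF P])
  then show "P \<noteq> A" by auto
  show "t_ideal F A P" using assms by (simp add: t_Spec_def)
qed

text \<open>A nonzero \<open>y\<close> in the closure would make \<open>y F\<close> part of
  \<open>A\<close>, hence \<open>A = F\<close>. This is where \<open>proper\<close> enters, and it
  makes the zero ideal a \<open>t\<close>-ideal.\<close>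

lemma v_closure_zero:
  assumes "S \<subseteq> {\<zero>}"
  shows "v_closure F A S \<subseteq> {\<zero>}"
proof
  fix y assume y: "y \<in> v_closure F A S"
  have S: "\<forall>q\<in>carrier F. \<forall>x\<in>S. q \<otimes> x \<in> A" using assms by auto
  have "y = \<zero>"
  proof (rule ccontr)
    assume nz: "y \<noteq> \<zero>"
    have yc: "y \<in> carrier F" using y v_closure_iff by blast
    have "x \<in> A" if "x \<in> carrier F" for x
    proof -
      have "y \<otimes> q \<in> A" if "q \<in> carrier F" for q using y S that unfolding v_closure_iff by blast
      from this[of "inv y \<otimes> x"] show ?thesis using nz yc that by simp
    qed
    then show False using proper by auto
  qed
  then show "y \<in> {\<zero>}" by simp
qed

section \<open>Valuation localizations belong to \<open>t\<close>-primes\<close>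

text \<open>In a valuation ring the generator \<open>x\<close> of least value divides all the
  others, and a common denominator \<open>s\<close> works for finitely many quotients. The inductive
  step compares the old \<open>x\<close> with the new element \<open>w\<close>.\<close>

lemma finite_subset_principal_in_valuation:
  assumes P: "primeideal P R" and V: "valuation_ring F (localization_at F A P)"
    and S: "finite S" "S \<subseteq> A"
  shows "S \<subseteq> {\<zero>} \<or> (\<exists>x\<in>S - {\<zero>}. \<exists>s\<in>A - P. \<forall>z\<in>S. s \<otimes> (inv x \<otimes> z) \<in> A)"
  using S
proof (induction S)
  case empty
  then show ?case by simp
next
  case (insert w S)
  then have wA: "w \<in> A" and SA: "S \<subseteq> A" by auto
  show ?case
  proof (cases "w = \<zero>")
    case True
    show ?thesis
    proof (cases "S \<subseteq> {\<zero>}")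
      case False
      then obtain x s where xs: "x \<in> S - {\<zero>}" "s \<in> A - P" "\<forall>z\<in>S. s \<otimes> (inv x \<otimes> z) \<in> A"
        using insert SA by blast
      have "\<forall>z\<in>insert w S. s \<otimes> (inv x \<otimes> z) \<in> A" using xs SA True by auto
      then show ?thesis using xs by blast
    qed (use True in auto)
  next
    case w: False
    show ?thesis
    proof (cases "S \<subseteq> {\<zero>}")
      case True
      have "\<forall>z\<in>insert w S. \<one> \<otimes> (inv w \<otimes> z) \<in> A" using wA w True by auto
      then show ?thesis using wA w primeD(2)[OF P] A_closed(2) by blast
    next
      case False
      then obtain x s where xs: "x \<in> S" "x \<noteq> \<zero>" "s \<in> A" "s \<notin> P" "\<forall>z\<in>S. s \<otimes> (inv x \<otimes> z) \<in> A"
        using insert SA by blast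
      then have xA: "x \<in> A" using SA by blast
      have "inv x \<otimes> w \<in> carrier F - {\<zero>}"
        using xA xs wA w by (auto simp: integral_iff)
      moreover have "inv (inv x \<otimes> w) = inv w \<otimes> x"
        using xA xs wA w by (intro comm_inv_char) (auto simp: m_ac)
      ultimately consider "inv x \<otimes> w \<in> localization_at F A P" | "inv w \<otimes> x \<in> localization_at F A P"
        using V unfolding valuation_ring_def by metis
      then show ?thesis
      proof cases
        case 1
        then obtain t where t: "t \<in> A" "t \<notin> P" "t \<otimes> (inv x \<otimes> w) \<in> A"
          using in_localization_iff[OF P] by blast
        have "(s \<otimes> t) \<otimes> (inv x \<otimes> z) \<in> A" if "z \<in> insert w S" for z
        proof (cases "z = w")
          case True
          then show ?thesis using t xs xA wA by (simp add: m_assoc)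
        next
          case False
          then have z: "z \<in> S" "z \<in> A" using that SA by auto
          have "(s \<otimes> t) \<otimes> (inv x \<otimes> z) = t \<otimes> (s \<otimes> (inv x \<otimes> z))"
            using t xs xA z by (simp add: m_assoc m_lcomm[of s t])
          then show ?thesis using t xs z by simp
        qed
        moreover have "s \<otimes> t \<in> A - P" using prime_complement_mult[OF P] xs t by blast
        ultimately show ?thesis using xs by blast
      next
        \<comment> \<open>Now \<open>w\<close> takes over as the divisor, because \<open>z/w\<close>
          is the product of \<open>z/x\<close> and \<open>x/w\<close>.\<close>
        case 2
        then obtain t where t: "t \<in> A" "t \<notin> P" "t \<otimes> (inv w \<otimes> x) \<in> A"
          using in_localization_iff[OF P] by blast
        have "(s \<otimes> t) \<otimes> (inv w \<otimes> z) \<in> A" if "z \<in> insert w S" for z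
        proof (cases "z = w")
          case True
          then show ?thesis using t xs xA wA w by (simp add: m_assoc)
        next
          case False
          then have z: "z \<in> S" "z \<in> A" using that SA by auto
          have "(s \<otimes> (inv x \<otimes> z)) \<otimes> (t \<otimes> (inv w \<otimes> x)) = s \<otimes> (inv x \<otimes> (z \<otimes> (t \<otimes> (inv w \<otimes> x))))"
            using t xs xA z wA w by (simp add: m_assoc)
          also have "z \<otimes> (t \<otimes> (inv w \<otimes> x)) = x \<otimes> (t \<otimes> (inv w \<otimes> z))"
            using t xs xA z wA w by (simp add: m_ac)
          finally have "(s \<otimes> t) \<otimes> (inv w \<otimes> z) = (s \<otimes> (inv x \<otimes> z)) \<otimes> (t \<otimes> (inv w \<otimes> x))"
            using t xs xA z wA w by (simp add: m_assoc)
          then show ?thesis using t xs z by simp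
        qed
        moreover have "s \<otimes> t \<in> A - P" using prime_complement_mult[OF P] xs t by blast
        ultimately show ?thesis using w by blast
      qed
    qed
  qed
qed

text \<open>If \<open>x\<close> in \<open>S\<close> divides \<open>S\<close> up to a denominator
  \<open>s\<close> outside \<open>P\<close>, then \<open>s/x\<close> multiplies \<open>S\<close>
  into \<open>A\<close>; so \<open>s y\<close> is a multiple of \<open>x\<close> for every
  \<open>y\<close> in the closure, and it lies in \<open>P\<close>.\<close>

lemma t_prime_if_valuation:
  assumes P: "primeideal P R" and V: "valuation_ring F (localization_at F A P)"
  shows "P \<in> t_Spec F A"
  unfolding t_Spec_iff
proof (intro conjI allI impI P)
  fix S assume S: "finite S \<and> S \<subseteq> P"
  have PA: "P \<subseteq> A" using idealD(1)[OF primeD(1)[OF P]] by blast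
  with S have SA: "S \<subseteq> A" by blast
  show "v_closure F A S \<subseteq> P"
  proof (cases "S \<subseteq> {\<zero>}")
    case True
    then show ?thesis using v_closure_zero idealD(2)[OF primeD(1)[OF P]] by blast
  next
    case False
    then obtain x s where xs: "x \<in> S" "x \<noteq> \<zero>" "s \<in> A" "s \<notin> P" "\<forall>z\<in>S. s \<otimes> (inv x \<otimes> z) \<in> A"
      using finite_subset_principal_in_valuation[OF P V _ SA] S by blast
    then have xA: "x \<in> A" using SA by blast
    show ?thesis
    proof
      fix y assume y: "y \<in> v_closure F A S"
      then have yA: "y \<in> A" using v_closure_subset[OF SA] by blast
      have "\<forall>z\<in>S. (s \<otimes> inv x) \<otimes> z \<in> A" using xs xA SA by (auto simp: m_assoc subset_iff)
      moreover have "s \<otimes> inv x \<in> carrier F" using xs xA by simp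
      ultimately have *: "y \<otimes> (s \<otimes> inv x) \<in> A" using y v_closure_iff by blast
      have "s \<otimes> y = x \<otimes> (y \<otimes> (s \<otimes> inv x))"
        using xs xA yA by (simp add: m_lcomm[of x y] m_lcomm[of x s] m_comm)
      also have "\<dots> \<in> P" using idealD(5)[OF primeD(1)[OF P] *] xs S by blast
      finally show "y \<in> P" using primeD(3)[OF P, of s y] xs yA by blast
    qed
  qed
qed

section \<open>\<open>t\<close>-maximal ideals\<close>

lemma t_Max_prime:
  assumes M: "M \<in> t_Max F A"
  shows "M \<in> t_Spec F A"
proof -
  have tM: "t_ideal F A M" "M \<noteq> A" and max: "\<And>I. t_ideal F A I \<Longrightarrow> I \<noteq> A \<Longrightarrow> M \<subseteq> I \<Longrightarrow> I = M"
    using M by (auto simp: t_Max_def)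
  then have iM: "ideal M R" and vM: "\<And>S. finite S \<Longrightarrow> S \<subseteq> M \<Longrightarrow> v_closure F A S \<subseteq> M"
    by (auto simp: t_ideal_iff)
  have one: "\<one> \<notin> M"
  proof
    assume "\<one> \<in> M"
    then have "A \<subseteq> M" using idealD(5)[OF iM, of _ \<one>] by fastforce
    then show False using tM(2) idealD(1)[OF iM] by blast
  qed
  have "a \<in> M \<or> b \<in> M" if ab: "a \<in> A" "b \<in> A" "a \<otimes> b \<in> M" for a b
  proof (rule ccontr)
    assume not: "\<not> (a \<in> M \<or> b \<in> M)"
    txt \<open>The colon ideal of \<open>M\<close> by \<open>b\<close> is again a \<open>t\<close>-ideal, to which maximality of \<open>M\<close> applies.\<close>
    let ?N = "{x \<in> A. x \<otimes> b \<in> M}"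
    have "ideal ?N R"
      unfolding ideal_iff using ab idealD(2,3,4)[OF iM] by (auto simp: l_distr m_assoc)
    moreover have "v_closure F A S \<subseteq> ?N" if S: "finite S" "S \<subseteq> ?N" for S
    proof
      fix y assume y: "y \<in> v_closure F A S"
      have SA: "S \<subseteq> A" using S by blast
      then have yA: "y \<in> A" using y v_closure_subset by blast
      \<comment> \<open>If \<open>q\<close> multiplies \<open>S b\<close> into \<open>A\<close>,
        then \<open>q b\<close> multiplies \<open>S\<close> into \<open>A\<close>; this moves
        \<open>b\<close> across the closure.\<close>
      have "y \<otimes> b \<in> v_closure F A ((\<lambda>x. x \<otimes> b) ` S)"
        unfolding v_closure_iff
      proof (intro conjI ballI impI)
        show "y \<otimes> b \<in> carrier F" using yA ab by simp
        fix q assume q: "q \<in> carrier F" "\<forall>x\<in>(\<lambda>x. x \<otimes> b) ` S. q \<otimes> x \<in> A"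
        then have "\<forall>x\<in>S. (q \<otimes> b) \<otimes> x \<in> A" using ab SA by (auto simp: m_assoc m_comm[of b] subset_iff)
        then have "y \<otimes> (q \<otimes> b) \<in> A" using y q ab v_closure_iff by simp
        then show "y \<otimes> b \<otimes> q \<in> A" using q ab yA by (simp add: m_assoc m_comm[of b])
      qed
      also have "\<dots> \<subseteq> M" by (rule vM) (use S in auto)
      finally show "y \<in> ?N" using yA by simp
    qed
    ultimately have "t_ideal F A ?N" by (simp add: t_ideal_iff)
    moreover have "M \<subseteq> ?N" using idealD(1,5)[OF iM] ab by blast
    moreover have "a \<in> ?N" using ab by simp
    ultimately have "?N = A" using max not by blast
    then have "\<one> \<otimes> b \<in> M" using A_closed(2) by blast
    then show False using ab not by simp
  qed
  then have "primeideal M R" using iM one by (simp add: primeideal_iff)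
  then show ?thesis using vM by (simp add: t_Spec_iff)
qed

text \<open>Zorn's lemma applies since the \<open>t\<close>-condition concerns finite subsets only:
  a finite subset of the union of a chain lies in one member, and \<open>\<one>\<close> never
  enters.\<close>

lemma t_ideal_below_t_Max:
  assumes I: "t_ideal F A I" "I \<noteq> A"
  obtains M where "M \<in> t_Max F A" "I \<subseteq> M"
proof -
  let ?T = "{J. t_ideal F A J \<and> J \<noteq> A \<and> I \<subseteq> J}"
  have proper_iff: "J \<noteq> A \<longleftrightarrow> \<one> \<notin> J" if "ideal J R" for J
  proof
    assume "J \<noteq> A"
    show "\<one> \<notin> J"
    proof
      assume "\<one> \<in> J"
      then have "A \<subseteq> J" using idealD(5)[OF that, of _ \<one>] by fastforce
      then show False using \<open>J \<noteq> A\<close> idealD(1)[OF that] by blast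
    qed
  qed auto
  have "\<exists>M\<in>?T. \<forall>J\<in>?T. M \<subseteq> J \<longrightarrow> J = M"
  proof (rule subset_Zorn_nonempty)
    show "?T \<noteq> {}" using I by blast
  next
    fix C assume C: "C \<noteq> {}" "subset.chain ?T C"
    then have CT: "J \<in> C \<Longrightarrow> t_ideal F A J \<and> J \<noteq> A \<and> I \<subseteq> J" for J
      by (auto simp: subset_chain_def)
    have id: "J \<in> C \<Longrightarrow> ideal J R" for J using CT by (simp add: t_ideal_iff)
    have fin: "\<exists>J\<in>C. S \<subseteq> J" if "finite S" "S \<subseteq> \<Union>C" for S
      using finite_subset_Union_chain[OF that C] by blast
    have "ideal (\<Union>C) R"
      unfolding ideal_iff
    proof (intro conjI ballI)
      show "\<Union>C \<subseteq> A" using idealD(1)[OF id] by blast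
      show "\<zero> \<in> \<Union>C" using idealD(2)[OF id] C by blast
      show "x \<oplus> y \<in> \<Union>C" if xy: "x \<in> \<Union>C" "y \<in> \<Union>C" for x y
      proof -
        obtain J where "J \<in> C" "{x, y} \<subseteq> J" using fin[of "{x, y}"] xy by auto
        then show ?thesis using idealD(3)[OF id, of J x y] by blast
      qed
      show "a \<otimes> x \<in> \<Union>C" if "a \<in> A" "x \<in> \<Union>C" for a x
        using idealD(4)[OF id] that by blast
    qed
    moreover have "v_closure F A S \<subseteq> \<Union>C" if S: "finite S" "S \<subseteq> \<Union>C" for S
    proof -
      obtain J where J: "J \<in> C" "S \<subseteq> J" using fin[OF S] by blast
      then have "v_closure F A S \<subseteq> J" using CT S(1) by (simp add: t_ideal_iff)
      then show ?thesis using J(1) by blast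
    qed
    ultimately have t: "t_ideal F A (\<Union>C)" by (simp add: t_ideal_iff)
    have one: "\<one> \<notin> \<Union>C"
    proof
      assume "\<one> \<in> \<Union>C"
      then obtain J where J: "J \<in> C" "\<one> \<in> J" by (rule UnionE)
      then show False using CT[OF J(1)] proper_iff[OF id[OF J(1)]] by simp
    qed
    obtain J where J: "J \<in> C" using C(1) by blast
    then have "I \<subseteq> \<Union>C" using CT[OF J] by auto
    moreover have "\<Union>C \<noteq> A" using one A_closed(2) by metis
    ultimately show "\<Union>C \<in> ?T" using t by (intro CollectI conjI)
  qed
  then obtain M where M: "M \<in> ?T" "\<forall>J\<in>?T. M \<subseteq> J \<longrightarrow> J = M" by (rule bexE)
  have "J = M" if "t_ideal F A J" "J \<noteq> A" "M \<subseteq> J" for J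
  proof -
    have "J \<in> ?T" using that M(1) by (simp add: subset_trans[of I M J])
    then show ?thesis using M(2) that by simp
  qed
  then have "M \<in> t_Max F A" using M(1) by (simp add: t_Max_def)
  then show ?thesis using that M(1) by simp
qed

section \<open>Finite character of the \<open>t\<close>-closure and limits of
  \<open>t\<close>-primes\<close>

lemma in_localization_if_colon:
  assumes P: "primeideal P R" and "G \<subseteq> A" "t \<in> colon F A G" "g \<in> G" "g \<notin> P"
  shows "t \<in> localization_at F A P"
proof (rule in_localizationI[OF P])
  show "g \<in> A" "g \<notin> P" "t \<in> carrier F" using assms by (auto simp: colon_iff)
  then show "g \<otimes> t \<in> A" using assms by (simp add: colon_iff m_comm[of g t])
qed

lemma ideal_v_closure: "ideal (A \<inter> v_closure F A S) R"
  unfolding ideal_iff by (auto simp: v_closure_iff l_distr m_assoc)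

text \<open>Finite subsets are directed under union, so their \<open>v\<close>-closures already
  unite to an ideal and no genuine sums arise. It turns \<open>\<one>\<close> in a
  \<open>t\<close>-closure into a statement about one finite set.\<close>

lemma t_closure_finite_character:
  assumes K: "K \<subseteq> A" and x: "x \<in> t_closure F A K"
  obtains S where "finite S" "S \<subseteq> K" "x \<in> v_closure F A S"
proof -
  let ?N = "{x \<in> A. \<exists>S. finite S \<and> S \<subseteq> K \<and> x \<in> v_closure F A S}"
  have N: "ideal ?N R"
    unfolding ideal_iff
  proof (intro conjI ballI)
    show "?N \<subseteq> A" by blast
    show "\<zero> \<in> ?N" using idealD(2)[OF ideal_v_closure, of "{}"] by blast
    show "a \<otimes> x \<in> ?N" if "a \<in> A" "x \<in> ?N" for a x
      using idealD(4)[OF ideal_v_closure that(1)] that(2) by blast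
    show "x \<oplus> y \<in> ?N" if xy: "x \<in> ?N" "y \<in> ?N" for x y
    proof -
      obtain S T where ST: "finite S" "S \<subseteq> K" "x \<in> v_closure F A S" "finite T" "T \<subseteq> K" "y \<in> v_closure F A T"
        using xy by blast
      then have "x \<in> A \<inter> v_closure F A (S \<union> T)" "y \<in> A \<inter> v_closure F A (S \<union> T)"
        using v_closure_mono[of S "S \<union> T"] v_closure_mono[of T "S \<union> T"] xy by blast+
      then have "x \<oplus> y \<in> A \<inter> v_closure F A (S \<union> T)" by (rule idealD(3)[OF ideal_v_closure])
      then show ?thesis using ST by blast
    qed
  qed
  have "\<Union>{v_closure F A J | J. fg_ideal J R \<and> J \<subseteq> K} \<subseteq> ?N"
  proof (rule Union_least, clarify)
    fix J y assume J: "fg_ideal J R" "J \<subseteq> K" and y: "y \<in> v_closure F A J"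
    then obtain S where S: "finite S" "S \<subseteq> A" "J = Idl\<^bsub>R\<^esub> S" by (auto simp: fg_ideal_iff)
    then have "S \<subseteq> K" using ring.genideal_self[OF ring_R, of S] J by auto
    moreover have "y \<in> v_closure F A S" using S y v_closure_Idl by simp
    ultimately show "y \<in> A \<and> (\<exists>S. finite S \<and> S \<subseteq> K \<and> y \<in> v_closure F A S)"
      using S v_closure_subset by blast
  qed
  then have "t_closure F A K \<subseteq> ?N"
    unfolding t_closure_def by (rule ring.genideal_minimal[OF ring_R N])
  then show ?thesis using x that by blast
qed

text \<open>The set \<open>T\<close> collects the second factors \<open>j\<close> of an expression
  of \<open>k\<close> as a sum of products \<open>i j\<close>. For each such \<open>j\<close>, the
  elements of \<open>A\<close> that \<open>j\<close> multiplies into \<open>P\<close> form an ideal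
  containing \<open>G\<close>, hence containing \<open>i\<close>.\<close>

lemma ideal_prod_colon_finite:
  assumes G: "G \<subseteq> A" and k: "k \<in> ideal_prod F (Idl\<^bsub>R\<^esub> G) (colon F A G)"
  shows "\<exists>T. finite T \<and> T \<subseteq> colon F A G \<and> (\<forall>P. ideal P R \<and> (\<forall>g\<in>G. \<forall>t\<in>T. g \<otimes> t \<in> P) \<longrightarrow> k \<in> P)"
  using k
proof induction
  case (prod i j)
  have "i \<otimes> j \<in> P" if P: "ideal P R" "\<forall>g\<in>G. g \<otimes> j \<in> P" for P
  proof -
    have "j \<in> carrier F" using prod by (simp add: colon_iff)
    then have "ideal {x \<in> A. x \<otimes> j \<in> P} R"
      using idealD(2,3,4)[OF P(1)] unfolding ideal_iff by (auto simp: l_distr m_assoc)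
    moreover have "G \<subseteq> {x \<in> A. x \<otimes> j \<in> P}" using G P by blast
    ultimately have "Idl\<^bsub>R\<^esub> G \<subseteq> {x \<in> A. x \<otimes> j \<in> P}" by (rule ring.genideal_minimal[OF ring_R])
    then show ?thesis using prod by blast
  qed
  then show ?case using prod by (intro exI[of _ "{j}"]) auto
next
  case (sum s1 s2)
  let ?Q = "\<lambda>T k. finite T \<and> T \<subseteq> colon F A G \<and>
    (\<forall>P. ideal P R \<and> (\<forall>g\<in>G. \<forall>t\<in>T. g \<otimes> t \<in> P) \<longrightarrow> k \<in> P)"
  obtain T1 where T1: "?Q T1 s1" using sum.IH(1) by (rule exE)
  obtain T2 where T2: "?Q T2 s2" using sum.IH(2) by (rule exE)
  have "s1 \<oplus> s2 \<in> P" if P: "ideal P R" "\<forall>g\<in>G. \<forall>t\<in>T1 \<union> T2. g \<otimes> t \<in> P" for P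
    by (rule idealD(3)[OF P(1)]) (use T1 T2 P in simp_all)
  then have "?Q (T1 \<union> T2) (s1 \<oplus> s2)" using T1 T2 by simp
  then show ?case by (rule exI)
qed

lemma t_prime_limit:
  fixes P :: "nat \<Rightarrow> 'a set"
  assumes P: "\<And>n. P n \<in> t_Spec F A"
  obtains Q where "Q \<in> t_Spec F A"
    "\<And>a N. a \<in> A \<Longrightarrow> (\<And>m. m > N \<Longrightarrow> a \<in> P m) \<Longrightarrow> a \<in> Q"
    "\<And>S. finite S \<Longrightarrow> S \<subseteq> Q \<Longrightarrow> infinite {m. S \<subseteq> P m}"
proof -
  txt \<open>In place of a limit along an ultrafilter, \<open>Q\<close> is a maximal set whose finite subsets are
    contained in infinitely many of the \<open>P n\<close>; maximality alone makes it a \<open>t\<close>-prime.\<close>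
  define T where "T = {K. K \<subseteq> A \<and> (\<forall>S. finite S \<and> S \<subseteq> K \<longrightarrow> infinite {m. S \<subseteq> P m})}"
  have T_iff: "K \<in> T \<longleftrightarrow> K \<subseteq> A \<and> (\<forall>S. finite S \<and> S \<subseteq> K \<longrightarrow> infinite {m. S \<subseteq> P m})" for K
    unfolding T_def by (rule mem_Collect_eq)
  have "\<exists>Q\<in>T. \<forall>K\<in>T. Q \<subseteq> K \<longrightarrow> K = Q"
  proof (rule subset_Zorn_nonempty)
    have "{} \<in> T" by (simp add: T_iff)
    then show "T \<noteq> {}" by blast
  next
    fix C assume C: "C \<noteq> {}" "subset.chain T C"
    then have CT: "C \<subseteq> T" by (simp add: subset_chain_def)
    have "infinite {m. S \<subseteq> P m}" if S: "finite S" "S \<subseteq> \<Union>C" for S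
    proof -
      obtain J where "J \<in> C" "S \<subseteq> J" using finite_subset_Union_chain[OF S C] by blast
      then have "J \<in> T" using CT by blast
      then show ?thesis using S(1) \<open>S \<subseteq> J\<close> unfolding T_iff by blast
    qed
    moreover have "\<Union>C \<subseteq> A" using CT T_iff by (meson Union_least subsetD)
    ultimately show "\<Union>C \<in> T" unfolding T_iff by blast
  qed
  then obtain Q where Q: "Q \<in> T" "\<forall>K\<in>T. Q \<subseteq> K \<longrightarrow> K = Q" by (rule bexE)
  have QA: "Q \<subseteq> A" using Q(1) unfolding T_iff by (rule conjunct1)
  have inf: "infinite {m. S \<subseteq> P m}" if "finite S" "S \<subseteq> Q" for S using Q(1) that unfolding T_iff by blast
  \<comment> \<open>By maximality \<open>a\<close> cannot be adjoined to \<open>Q\<close>, so some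
    finite part of \<open>Q\<close> is compatible with \<open>a\<close> at finitely many indices
    only.\<close>
  have out: "\<exists>S. finite S \<and> S \<subseteq> Q \<and> finite {m. S \<subseteq> P m \<and> a \<in> P m}" if a: "a \<in> A" "a \<notin> Q" for a
  proof -
    have "insert a Q \<notin> T"
    proof
      assume "insert a Q \<in> T"
      then have "insert a Q = Q" using bspec[OF Q(2)] subset_insertI by metis
      then show False using a(2) by blast
    qed
    moreover have "insert a Q \<subseteq> A" using a(1) QA by simp
    ultimately obtain S where S: "finite S" "S \<subseteq> insert a Q" "finite {m. S \<subseteq> P m}"
      unfolding T_iff by blast
    have "finite {m. S - {a} \<subseteq> P m \<and> a \<in> P m}" by (rule finite_subset[OF _ S(3)]) blast
    moreover have "finite (S - {a})" "S - {a} \<subseteq> Q" using S by auto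
    ultimately show ?thesis by blast
  qed
  \<comment> \<open>Whatever follows from a finite part of \<open>Q\<close> at almost every index is
    in \<open>Q\<close>; the ideal and \<open>v\<close>-closure properties pass from the
    \<open>P m\<close> to \<open>Q\<close> in this way.\<close>
  have mem: "a \<in> Q" if a: "a \<in> A" and T: "finite T" "T \<subseteq> Q" and imp: "finite {m. T \<subseteq> P m \<and> a \<notin> P m}" for a T
  proof (rule ccontr)
    assume "a \<notin> Q"
    then obtain S where S: "finite S" "S \<subseteq> Q" "finite {m. S \<subseteq> P m \<and> a \<in> P m}" using out[OF a] by blast
    have "finite {m. S \<union> T \<subseteq> P m}"
      by (rule finite_subset[OF _ finite_UnI[OF imp S(3)]]) blast
    then show False using inf[of "S \<union> T"] S T by simp
  qed
  have mem': "a \<in> Q" if "a \<in> A" "finite T" "T \<subseteq> Q" "\<And>m. T \<subseteq> P m \<Longrightarrow> a \<in> P m" for a T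
  proof -
    have none: "{m. T \<subseteq> P m \<and> a \<notin> P m} = {}" using that(4) by blast
    show ?thesis by (rule mem[OF that(1-3)]) (simp add: none)
  qed
  have pP: "primeideal (P n) R" and iP: "ideal (P n) R" for n
    using t_Spec_prime[OF P] primeD(1) by auto
  have iQ: "ideal Q R"
    unfolding ideal_iff
  proof (intro conjI ballI QA)
    show "\<zero> \<in> Q" by (rule mem'[of _ "{}"]) (use idealD(2)[OF iP] in auto)
    show "x \<oplus> y \<in> Q" if "x \<in> Q" "y \<in> Q" for x y
      by (rule mem'[of _ "{x, y}"]) (use idealD(3)[OF iP] that QA in \<open>auto simp: subset_iff\<close>)
    show "a \<otimes> x \<in> Q" if "a \<in> A" "x \<in> Q" for a x
      by (rule mem'[of _ "{x}"]) (use idealD(4)[OF iP] that QA in auto)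
  qed
  moreover have "\<one> \<notin> Q" using inf[of "{\<one>}"] primeD(2)[OF pP] by auto
  moreover have "a \<in> Q \<or> b \<in> Q" if ab: "a \<in> A" "b \<in> A" "a \<otimes> b \<in> Q" for a b
  proof (rule ccontr)
    assume not: "\<not> (a \<in> Q \<or> b \<in> Q)"
    then obtain S where S: "finite S" "S \<subseteq> Q" "finite {m. S \<subseteq> P m \<and> a \<in> P m}" using out[of a] ab by blast
    from not obtain T where T: "finite T" "T \<subseteq> Q" "finite {m. T \<subseteq> P m \<and> b \<in> P m}" using out[of b] ab by blast
    \<comment> \<open>A prime \<open>P m\<close> containing the product contains \<open>a\<close> or
      \<open>b\<close>, so these indices fall into two finite sets.\<close>
    have "finite {m. insert (a \<otimes> b) (S \<union> T) \<subseteq> P m}"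
      by (rule finite_subset[OF _ finite_UnI[OF S(3) T(3)]]) (use primeD(3)[OF pP ab(1,2)] in auto)
    then show False using inf[of "insert (a \<otimes> b) (S \<union> T)"] S T ab by simp
  qed
  ultimately have pQ: "primeideal Q R" by (simp add: primeideal_iff)
  have "v_closure F A S \<subseteq> Q" if S: "finite S" "S \<subseteq> Q" for S
  proof
    fix y assume y: "y \<in> v_closure F A S"
    have "y \<in> A" using y v_closure_subset[of S] S QA by blast
    then show "y \<in> Q"
    proof (rule mem'[OF _ S])
      fix m assume "S \<subseteq> P m"
      then have "v_closure F A S \<subseteq> P m" using P[of m] S(1) by (simp add: t_Spec_iff)
      then show "y \<in> P m" using y by blast
    qed
  qed
  then have "Q \<in> t_Spec F A" using pQ by (simp add: t_Spec_iff)
  moreover have "a \<in> Q" if a: "a \<in> A" "\<And>m. m > N \<Longrightarrow> a \<in> P m" for a N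
  proof (rule mem[of _ "{}"])
    have "{m. {} \<subseteq> P m \<and> a \<notin> P m} \<subseteq> {..N}" using a(2) by (auto simp: not_less[symmetric])
    then show "finite {m. {} \<subseteq> P m \<and> a \<notin> P m}" by (rule finite_subset) simp
  qed (use a in auto)
  ultimately show ?thesis using that inf by presburger
qed

section \<open>Valuation rings above a localization, and changes of a representation\<close>

lemma valuation_ring_carrier: "valuation_ring F (carrier F)"
  using carrier_is_subring by (simp add: valuation_ring_def)

text \<open>For \<open>w\<close> in \<open>W\<close> outside \<open>A\<^sub>P\<close> the inverse of
  \<open>w\<close> is in \<open>A\<^sub>P\<close>, and \<open>c\<close> is its numerator
  \<open>s inv w\<close>. If \<open>c\<close> were outside \<open>P\<close>, then \<open>w\<close>,
  which is \<open>s inv c\<close>, would be in \<open>A\<^sub>P\<close>.\<close>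

lemma proper_valuation_overring_inverse:
  assumes P: "primeideal P R" and V: "valuation_ring F (localization_at F A P)"
    and W: "subring W F" "localization_at F A P \<subset> W"
  obtains c where "c \<in> P" "c \<noteq> \<zero>" "inv c \<in> W"
proof -
  obtain w where w: "w \<in> W" "w \<notin> localization_at F A P" using W(2) by blast
  have wc: "w \<in> carrier F" using w(1) subringE(1)[OF W(1)] by blast
  have w0: "w \<noteq> \<zero>" using w(2) subringE(2)[OF subring_localization[OF P]] by metis
  then have "inv w \<in> localization_at F A P" using V w(2) wc unfolding valuation_ring_def by blast
  then obtain s where s: "s \<in> A" "s \<notin> P" "s \<otimes> inv w \<in> A" using in_localization_iff[OF P] by blast
  have s0: "s \<noteq> \<zero>" using s(2) idealD(2)[OF primeD(1)[OF P]] by metis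
  let ?c = "s \<otimes> inv w"
  have c0: "?c \<noteq> \<zero>" using s s0 wc w0 by (simp add: integral_iff)
  have ic: "inv ?c = w \<otimes> inv s" using s s0 wc w0 by (intro comm_inv_char) (auto simp: m_ac)
  have "inv s \<in> localization_at F A P" using inv_in_localization[OF P s(1) s0] s(2) by simp
  then have "inv ?c \<in> W" unfolding ic using W subringE(6)[OF W(1) w(1)] by blast
  moreover have "?c \<in> P"
  proof (rule ccontr)
    assume "?c \<notin> P"
    then have "inv ?c \<in> localization_at F A P" using inv_in_localization[OF P s(3) c0] by simp
    then have "s \<otimes> inv ?c \<in> localization_at F A P"
      using subringE(6)[OF subring_localization[OF P]] subset_localization[OF P] s(1) by blast
    moreover have "s \<otimes> inv ?c = w" unfolding ic using s s0 wc by (simp add: m_lcomm[of s w])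
    ultimately show False using w(2) by simp
  qed
  ultimately show ?thesis using that c0 by blast
qed

text \<open>The set is the center of \<open>W\<close> on \<open>A\<close>, the trace of the nonunits
  of \<open>W\<close>. Additivity rests on comparing \<open>x\<close> and \<open>y\<close> by the
  valuation property that \<open>W\<close> inherits, and the inclusion holds because elements
  outside \<open>P\<close> are already inverted in \<open>A\<^sub>P\<close>.\<close>

lemma valuation_center_prime:
  assumes P: "primeideal P R" and V: "valuation_ring F (localization_at F A P)"
    and W: "subring W F" "localization_at F A P \<subseteq> W"
  shows "primeideal {a \<in> A. a = \<zero> \<or> inv a \<notin> W} R" (is "primeideal ?Q R")
    and "{a \<in> A. a = \<zero> \<or> inv a \<notin> W} \<subseteq> P"
proof -
  have AW: "x \<in> W" if "x \<in> A" for x using that subset_localization[OF P] W(2) by blast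
  have Wm: "x \<otimes> y \<in> W" if "x \<in> W" "y \<in> W" for x y using subringE(6)[OF W(1) that] .
  have Wa: "x \<oplus> y \<in> W" if "x \<in> W" "y \<in> W" for x y using subringE(7)[OF W(1) that] .
  have mult: "a \<otimes> x \<in> ?Q" if "a \<in> A" "x \<in> ?Q" for a x
  proof (rule ccontr)
    assume not: "a \<otimes> x \<notin> ?Q"
    have x: "x \<in> A" "x = \<zero> \<or> inv x \<notin> W" using that(2) by auto
    have ax: "a \<otimes> x \<noteq> \<zero>" "inv (a \<otimes> x) \<in> W" using not that(1) x(1) by auto
    then have nz: "a \<noteq> \<zero>" "x \<noteq> \<zero>" using that(1) x(1) by auto
    then have "inv x = a \<otimes> inv (a \<otimes> x)"
      using that(1) x(1) ax(1) by (intro comm_inv_char) (auto simp: m_assoc[symmetric] m_comm[of x a])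
    then show False using Wm[OF AW[OF that(1)] ax(2)] x(2) nz by simp
  qed
  \<comment> \<open>If \<open>x + y\<close> were a unit of \<open>W\<close>, then
    \<open>inv y\<close> would be \<open>x/y + 1\<close> divided by \<open>x + y\<close>, hence in
    \<open>W\<close>.\<close>
  have add: "x \<oplus> y \<in> ?Q" if xy: "x \<in> A" "x = \<zero> \<or> inv x \<notin> W" "y \<in> A" "y \<noteq> \<zero>" "inv y \<notin> W"
    and loc: "x \<otimes> inv y \<in> W" for x y
  proof (rule ccontr)
    assume "x \<oplus> y \<notin> ?Q"
    then have s: "x \<oplus> y \<noteq> \<zero>" "inv (x \<oplus> y) \<in> W" using xy by auto
    have "x \<otimes> inv y \<oplus> \<one> \<in> W" using Wa[OF loc AW[OF A_closed(2)]] .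
    then have "(x \<otimes> inv y \<oplus> \<one>) \<otimes> inv (x \<oplus> y) \<in> W" using Wm s(2) by blast
    moreover have "x \<otimes> inv y \<oplus> \<one> = (x \<oplus> y) \<otimes> inv y" using xy by (simp add: l_distr)
    ultimately have "(x \<oplus> y) \<otimes> inv y \<otimes> inv (x \<oplus> y) \<in> W" by simp
    moreover have "(x \<oplus> y) \<otimes> inv y \<otimes> inv (x \<oplus> y) = inv y"
      using xy s(1) by (simp add: m_assoc m_comm[of "inv y"])
    ultimately show False using xy(5) by simp
  qed
  have "x \<oplus> y \<in> ?Q" if "x \<in> ?Q" "y \<in> ?Q" for x y
  proof -
    have xy: "x \<in> A" "x = \<zero> \<or> inv x \<notin> W" "y \<in> A" "y = \<zero> \<or> inv y \<notin> W" using that by auto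
    show ?thesis
    proof (cases "x = \<zero> \<or> y = \<zero>")
      case True
      then show ?thesis using that xy by auto
    next
      case False
      then have "x \<otimes> inv y \<in> carrier F - {\<zero>}" using xy by (auto simp: integral_iff)
      moreover have "inv (x \<otimes> inv y) = y \<otimes> inv x"
        using False xy by (intro comm_inv_char) (auto simp: m_ac)
      ultimately have "x \<otimes> inv y \<in> W \<or> y \<otimes> inv x \<in> W"
        using V W(2) unfolding valuation_ring_def by (metis subsetD)
      moreover have "x \<oplus> y = y \<oplus> x" using xy by (simp add: a_comm)
      ultimately show ?thesis using add[of x y] add[of y x] False xy by auto
    qed
  qed
  then have "ideal ?Q R" using mult unfolding ideal_iff by simp
  moreover have "\<one> \<notin> ?Q" using AW[OF A_closed(2)] by simp
  moreover have "a \<in> ?Q \<or> b \<in> ?Q" if ab: "a \<in> A" "b \<in> A" "a \<otimes> b \<in> ?Q" for a b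
  proof (rule ccontr)
    assume "\<not> (a \<in> ?Q \<or> b \<in> ?Q)"
    then have n: "a \<noteq> \<zero>" "b \<noteq> \<zero>" "inv a \<in> W" "inv b \<in> W" using ab by auto
    have "inv (a \<otimes> b) = inv a \<otimes> inv b" using n ab by (intro comm_inv_char) (auto simp: m_ac)
    then have "inv (a \<otimes> b) \<in> W" using Wm n by simp
    then show False using ab n by (simp add: integral_iff)
  qed
  ultimately show "primeideal ?Q R" by (simp add: primeideal_iff)
  show "?Q \<subseteq> P"
  proof
    fix a assume a: "a \<in> ?Q"
    then show "a \<in> P"
      using inv_in_localization[OF P, of a] W(2) idealD(2)[OF primeD(1)[OF P]] by blast
  qed
qed

lemma representation_insert:
  assumes Y: "representation F A B Y" and Z: "Y \<subseteq> Z" "\<And>W. W \<in> Z \<Longrightarrow> valuation_ring F W \<and> B \<subseteq> W"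
  shows "representation F A B Z"
proof -
  have B: "subring B F" "A \<subseteq> B" "B \<subset> carrier F" "B = carrier F \<inter> \<Inter>Y"
    using Y unfolding representation_def by blast+
  have "B = carrier F \<inter> \<Inter>Z"
  proof
    show "B \<subseteq> carrier F \<inter> \<Inter>Z" using B(3) Z(2) by blast
    show "carrier F \<inter> \<Inter>Z \<subseteq> B" by (subst B(4)) (use Z(1) in blast)
  qed
  then show ?thesis unfolding representation_def using B(1-3) Z(2) by blast
qed

lemma representation_remove:
  assumes "representation F A B Y" "\<Inter>(Y - {V}) \<subseteq> V"
  shows "representation F A B (Y - {V})"
proof -
  have "\<Inter>(Y - {V}) = \<Inter>Y" using assms(2) by blast
  then show ?thesis using assms(1) unfolding representation_def by (metis DiffD1)
qed

end

section \<open>Pruefer \<open>v\<close>-multiplication domains\<close>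

locale Pruefer_v_multiplication_domain = fraction_field +
  assumes PvMD: "PvMD F A"
begin

section \<open>Consequences of \<open>t\<close>-invertibility\<close>

text \<open>By \<open>t\<close>-invertibility and finite character, \<open>\<one>\<close> is in the
  \<open>v\<close>-closure of a finite \<open>S\<close> inside the product of the ideal with its
  inverse, and \<open>T\<close> collects the inverse elements used in \<open>S\<close>. A
  \<open>t\<close>-prime containing all \<open>g t\<close> would contain \<open>S\<close>, hence
  \<open>\<one>\<close>.\<close>

lemma finite_t_inverse:
  assumes G: "finite G" "G \<subseteq> A" "\<not> G \<subseteq> {\<zero>}"
  obtains T where "finite T" "T \<subseteq> colon F A G"
    "\<And>P. P \<in> t_Spec F A \<Longrightarrow> \<exists>g\<in>G. \<exists>t\<in>T. g \<otimes> t \<notin> P"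
proof -
  let ?I = "Idl\<^bsub>R\<^esub> G" let ?K = "ideal_prod F ?I (colon F A G)"
  have GI: "G \<subseteq> ?I" using ring.genideal_self[OF ring_R, of G] G by simp
  then have "?I \<noteq> {\<zero>}" using G by blast
  moreover have "fg_ideal ?I R" using G by (auto simp: fg_ideal_iff)
  ultimately have K: "t_closure F A ?K = A"
    using PvMD colon_Idl[OF G(2)] by (auto simp: PvMD_def t_invertible_def)
  have "k \<in> A" if "k \<in> ?K" for k
    using that
  proof induction
    case (prod i j)
    then have "j \<in> colon F A ?I" by (simp add: colon_Idl G)
    then have "j \<in> carrier F" "j \<otimes> i \<in> A" using prod by (auto simp: colon_iff)
    moreover have "i \<in> A" using ring.genideal_ideal[OF ring_R, of G] G prod idealD(1) by auto
    ultimately show ?case by (simp add: m_comm)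
  qed simp
  then have "?K \<subseteq> A" by blast
  then obtain S where S: "finite S" "S \<subseteq> ?K" "\<one> \<in> v_closure F A S"
    using t_closure_finite_character[of ?K \<one>] K A_closed(2) by metis
  have "\<forall>k\<in>S. \<exists>T. finite T \<and> T \<subseteq> colon F A G \<and>
      (\<forall>P. ideal P R \<and> (\<forall>g\<in>G. \<forall>t\<in>T. g \<otimes> t \<in> P) \<longrightarrow> k \<in> P)"
    using ideal_prod_colon_finite[OF G(2)] S(2) by blast
  from bchoice[OF this] obtain T where T: "\<forall>k\<in>S. finite (T k) \<and> T k \<subseteq> colon F A G \<and>
      (\<forall>P. ideal P R \<and> (\<forall>g\<in>G. \<forall>t\<in>T k. g \<otimes> t \<in> P) \<longrightarrow> k \<in> P)" ..
  show ?thesis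
  proof (rule that[of "\<Union>(T ` S)"])
    show "finite (\<Union>(T ` S))" using S(1) T by simp
    show "\<Union>(T ` S) \<subseteq> colon F A G" by (rule UN_least) (use T in simp)
    fix P assume P: "P \<in> t_Spec F A"
    show "\<exists>g\<in>G. \<exists>t\<in>\<Union>(T ` S). g \<otimes> t \<notin> P"
    proof (rule ccontr)
      assume not: "\<not> ?thesis"
      have "S \<subseteq> P"
      proof
        fix k assume k: "k \<in> S"
        then have "\<forall>g\<in>G. \<forall>t\<in>T k. g \<otimes> t \<in> P" using not by simp
        then show "k \<in> P" using T k primeD(1)[OF t_Spec_prime[OF P]] by simp
      qed
      then have "v_closure F A S \<subseteq> P" using P S(1) by (simp add: t_Spec_iff)
      then show False using S(3) t_SpecD(3)[OF P] by auto
    qed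
  qed
qed

text \<open>Write \<open>x\<close> as \<open>a/d\<close> and take \<open>T\<close> for the pair
  \<open>a, d\<close>. The products \<open>d t\<close> are denominators of \<open>x\<close>; if
  \<open>x\<close> is in \<open>A\<^sub>P\<close> and all of them are in \<open>P\<close>, so are
  the products \<open>a t\<close>, which contradicts the choice of \<open>T\<close>.\<close>

lemma localization_membership_finite:
  assumes x: "x \<in> carrier F"
  obtains S where "finite S" "S \<subseteq> A"
    "\<And>P. P \<in> t_Spec F A \<Longrightarrow> x \<in> localization_at F A P \<longleftrightarrow> \<not> S \<subseteq> P"
proof -
  obtain a d where ad: "a \<in> A" "d \<in> A" "d \<noteq> \<zero>" "x = a \<otimes> inv d"
    using quotient_field x unfolding quotient_field_def by blast
  have dx: "d \<otimes> x = a" using ad by (simp add: m_lcomm[of d a])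
  obtain T where T: "finite T" "T \<subseteq> colon F A {a, d}"
    "\<And>P. P \<in> t_Spec F A \<Longrightarrow> \<exists>g\<in>{a, d}. \<exists>t\<in>T. g \<otimes> t \<notin> P"
    using finite_t_inverse[of "{a, d}"] ad by auto
  have Tc: "t \<in> carrier F" "a \<otimes> t \<in> A" "d \<otimes> t \<in> A" if "t \<in> T" for t
    using T(2) that ad m_comm[of t] by (auto simp: colon_iff subset_iff)
  have dtx: "(d \<otimes> t) \<otimes> x = a \<otimes> t" if "t \<in> T" for t
  proof -
    have "(d \<otimes> t) \<otimes> x = (d \<otimes> x) \<otimes> t" using Tc that ad(2) x by (simp add: m_ac)
    then show ?thesis using dx by simp
  qed
  show ?thesis
  proof (rule that[of "(\<lambda>t. d \<otimes> t) ` T"])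
    fix P assume P: "P \<in> t_Spec F A"
    note pP = t_Spec_prime[OF P]
    show "x \<in> localization_at F A P \<longleftrightarrow> \<not> (\<lambda>t. d \<otimes> t) ` T \<subseteq> P"
    proof
      assume "\<not> (\<lambda>t. d \<otimes> t) ` T \<subseteq> P"
      then obtain t where "t \<in> T" "d \<otimes> t \<notin> P" by blast
      then show "x \<in> localization_at F A P"
        using dtx[of t] Tc[of t] x by (intro in_localizationI[OF pP, of "d \<otimes> t"]) auto
    next
      assume loc: "x \<in> localization_at F A P"
      show "\<not> (\<lambda>t. d \<otimes> t) ` T \<subseteq> P"
      proof
        assume sub: "(\<lambda>t. d \<otimes> t) ` T \<subseteq> P"
        then have "a \<otimes> t \<in> P" if "t \<in> T" for t
          using prime_mult_localization[OF pP _ loc, of "d \<otimes> t"] dtx[of t] Tc[of t] that by auto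
        then show False using T(3)[OF P] sub by blast
      qed
    qed
  qed (use T Tc in auto)
qed

text \<open>With \<open>x\<close> equal to \<open>a/d\<close> and a suitable \<open>t\<close> in the
  inverse of \<open>a, d\<close>, the fraction \<open>(a t)/(d t)\<close> or its reciprocal has its
  denominator outside \<open>P\<close>.\<close>

lemma valuation_localization:
  assumes P: "P \<in> t_Spec F A"
  shows "valuation_ring F (localization_at F A P)"
  unfolding valuation_ring_def
proof (intro conjI ballI)
  note pP = t_Spec_prime[OF P]
  show "subring (localization_at F A P) F" by (rule subring_localization[OF pP])
  fix x assume x: "x \<in> carrier F - {\<zero>}"
  then obtain a d where ad: "a \<in> A" "d \<in> A" "d \<noteq> \<zero>" "x = a \<otimes> inv d"
    using quotient_field unfolding quotient_field_def by blast
  have a0: "a \<noteq> \<zero>" using x ad by auto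
  obtain T where T: "finite T" "T \<subseteq> colon F A {a, d}"
    "\<And>P. P \<in> t_Spec F A \<Longrightarrow> \<exists>g\<in>{a, d}. \<exists>t\<in>T. g \<otimes> t \<notin> P"
    using finite_t_inverse[of "{a, d}"] ad by auto
  obtain g t where gt: "g \<in> {a, d}" "t \<in> T" "g \<otimes> t \<notin> P" using T(3)[OF P] by blast
  have t: "t \<in> carrier F" "a \<otimes> t \<in> A" "d \<otimes> t \<in> A"
    using T(2) gt ad m_comm[of t] by (auto simp: colon_iff subset_iff)
  have ix: "inv x = d \<otimes> inv a"
    using ad a0 by (intro comm_inv_char) (auto simp: m_ac)
  have "x \<in> localization_at F A P" if "g = d"
  proof (rule in_localizationI[OF pP, of "d \<otimes> t"])
    have "d \<otimes> t \<otimes> x = a \<otimes> t"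
      using ad t by (simp add: m_assoc m_lcomm[of d t] m_lcomm[of d a] m_comm[of t])
    then show "d \<otimes> t \<otimes> x \<in> A" using t by simp
  qed (use that gt t x in auto)
  moreover have "inv x \<in> localization_at F A P" if "g = a"
  proof (rule in_localizationI[OF pP, of "a \<otimes> t"])
    have "a \<otimes> t \<otimes> inv x = d \<otimes> t"
      unfolding ix using ad t a0 by (simp add: m_assoc m_lcomm[of a t] m_lcomm[of a d] m_comm[of t])
    then show "a \<otimes> t \<otimes> inv x \<in> A" using t by simp
  qed (use that gt t x in auto)
  ultimately show "x \<in> localization_at F A P \<or> inv x \<in> localization_at F A P" using gt by blast
qed

text \<open>Combines \<open>t_prime_if_valuation\<close> with \<open>valuation_localization\<close>;
  afterwards families of rings are handled as families of \<open>t\<close>-primes.\<close>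

lemma essential_valuation_overring_iff:
  "essential_valuation_overring F A V \<longleftrightarrow> (\<exists>P\<in>t_Spec F A. V = localization_at F A P)"
proof
  assume "essential_valuation_overring F A V"
  then obtain P where "primeideal P R" "V = localization_at F A P" "valuation_ring F V"
    unfolding essential_valuation_overring_def valuation_overring_def by auto
  then show "\<exists>P\<in>t_Spec F A. V = localization_at F A P"
    using t_prime_if_valuation by (intro bexI[of _ P]) simp_all
next
  assume "\<exists>P\<in>t_Spec F A. V = localization_at F A P"
  then obtain P where P: "P \<in> t_Spec F A" "V = localization_at F A P" by auto
  show "essential_valuation_overring F A V"
    unfolding essential_valuation_overring_def valuation_overring_def
    using P valuation_localization[OF P(1)] subset_localization[OF t_Spec_prime[OF P(1)]]
      t_Spec_prime[OF P(1)]
    by (intro conjI exI[of _ P]) simp_all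
qed

text \<open>A ring between a valuation ring and \<open>F\<close> is again a valuation ring, so
  \<open>t_prime_if_valuation\<close> applies to the smaller prime.\<close>

lemma t_Spec_downward_closed:
  assumes P: "P \<in> t_Spec F A" and Q: "primeideal Q R" "Q \<subseteq> P"
  shows "Q \<in> t_Spec F A"
proof (rule t_prime_if_valuation[OF Q(1)])
  have "localization_at F A P \<subseteq> localization_at F A Q"
    using localization_subset_iff[OF t_Spec_prime[OF P] Q(1)] Q(2) by simp
  moreover have "\<forall>x\<in>carrier F - {\<zero>}. x \<in> localization_at F A P \<or> inv x \<in> localization_at F A P"
    using valuation_localization[OF P] by (simp add: valuation_ring_def)
  ultimately show "valuation_ring F (localization_at F A Q)"
    using subring_localization[OF Q(1)] unfolding valuation_ring_def by blast
qed

lemma t_Spec_comparable: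
  assumes M: "M \<in> t_Spec F A" and "P \<in> t_Spec F A" "P \<subseteq> M" "Q \<in> t_Spec F A" "Q \<subseteq> M"
  shows "P \<subseteq> Q \<or> Q \<subseteq> P"
  using primes_below_valuation_comparable[OF t_Spec_prime[OF M] valuation_localization[OF M]]
    assms t_Spec_prime by blast

lemma localization_le_iff:
  assumes "P \<in> t_Spec F A" "Q \<in> t_Spec F A"
  shows "localization_at F A P \<subseteq> localization_at F A Q \<longleftrightarrow> Q \<subseteq> P"
  using localization_subset_iff assms t_Spec_prime by simp

text \<open>If \<open>x\<close> were outside \<open>A\<^sub>Q\<close>, the finite set deciding
  membership of \<open>x\<close> would lie in \<open>Q\<close>, hence in \<open>P m\<close> for
  infinitely many \<open>m\<close>, and some such \<open>m\<close> is at least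
  \<open>k\<close>.\<close>

lemma localization_limit:
  assumes Q: "Q \<in> t_Spec F A" and P: "\<And>n. P n \<in> t_Spec F A"
    and fin: "\<And>S. finite S \<Longrightarrow> S \<subseteq> Q \<Longrightarrow> infinite {m::nat. S \<subseteq> P m}"
    and x: "x \<in> carrier F" "\<And>m. m \<ge> k \<Longrightarrow> x \<in> localization_at F A (P m)"
  shows "x \<in> localization_at F A Q"
proof (rule ccontr)
  obtain S where S: "finite S" "S \<subseteq> A"
    "\<And>P. P \<in> t_Spec F A \<Longrightarrow> x \<in> localization_at F A P \<longleftrightarrow> \<not> S \<subseteq> P"
    using localization_membership_finite[OF x(1)] by metis
  assume "x \<notin> localization_at F A Q"
  then have "infinite {m. S \<subseteq> P m}" using S(3)[OF Q] fin[OF S(1)] by simp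
  moreover have "{m. S \<subseteq> P m} \<subseteq> {..<k}" using x(2) S(3)[OF P] by (auto simp: not_le[symmetric])
  ultimately show False using finite_subset by blast
qed

section \<open>Antichains of essential valuation overrings\<close>

abbreviation essential_antichain :: "'a set set \<Rightarrow> bool" where
  "essential_antichain Y \<equiv> Y \<noteq> {} \<and> Y \<noteq> {carrier F} \<and>
     (\<forall>V\<in>Y. essential_valuation_overring F A V) \<and> pairwise (\<lambda>V W. \<not> V \<subseteq> W) Y"

text \<open>Since \<open>F\<close> contains every other member, it could belong to an antichain only
  as its sole member; excluding the collection of \<open>F\<close> alone therefore makes
  \<open>V\<close> proper.\<close>

lemma essential_antichainE:
  assumes Y: "essential_antichain Y" and V: "V \<in> Y"
  obtains P where "P \<in> t_Spec F A" "V = localization_at F A P" "V \<subset> carrier F"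
    "\<And>W. W \<in> Y - {V} \<Longrightarrow>
      \<exists>Q\<in>t_Spec F A. W = localization_at F A Q \<and> \<not> P \<subseteq> Q \<and> \<not> Q \<subseteq> P"
proof -
  have ess: "\<exists>Q\<in>t_Spec F A. W = localization_at F A Q" if "W \<in> Y" for W
    using Y that by (simp add: essential_valuation_overring_iff)
  then obtain P where P: "P \<in> t_Spec F A" "V = localization_at F A P" using V by blast
  have sub: "W \<subseteq> carrier F" if "W \<in> Y" for W
    using ess[OF that] subring_localization[OF t_Spec_prime] subringE(1) by metis
  have inc: "\<not> W \<subseteq> V \<and> \<not> V \<subseteq> W" if "W \<in> Y - {V}" for W
    using Y V that unfolding pairwise_def by blast
  have "V \<noteq> carrier F"
  proof
    assume "V = carrier F"
    then have "Y - {V} = {}" using inc sub by blast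
    then show False using Y V \<open>V = carrier F\<close> by blast
  qed
  then have "V \<subset> carrier F" using sub[OF V] by blast
  moreover have "\<exists>Q\<in>t_Spec F A. W = localization_at F A Q \<and> \<not> P \<subseteq> Q \<and> \<not> Q \<subseteq> P" if W: "W \<in> Y - {V}" for W
  proof -
    obtain Q where Q: "Q \<in> t_Spec F A" "W = localization_at F A Q" using ess W by blast
    then show ?thesis
      using inc[OF W] P localization_le_iff[OF P(1) Q(1)] localization_le_iff[OF Q(1) P(1)] by auto
  qed
  ultimately show ?thesis using that P by blast
qed

lemma representation_essential_antichain:
  assumes Y: "essential_antichain Y"
  shows "representation F A (\<Inter>Y) Y"
proof -
  have val: "valuation_ring F V \<and> A \<subseteq> V" if "V \<in> Y" for V
    using Y that unfolding essential_valuation_overring_def valuation_overring_def by blast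
  then have sub: "subring V F" if "V \<in> Y" for V using that unfolding valuation_ring_def by blast
  obtain V where V: "V \<in> Y" using Y by blast
  then have "V \<subset> carrier F" using essential_antichainE[OF Y] by metis
  then have "\<Inter>Y \<subset> carrier F" using V by blast
  moreover have "subring (\<Inter>Y) F" using subring_Inter[of Y] sub Y by blast
  ultimately show ?thesis unfolding representation_def using val by blast
qed

text \<open>The element \<open>t\<close> is found in the \<open>t\<close>-inverse of the ideal generated by \<open>S \<union> {c}\<close>.\<close>

lemma separating_element:
  assumes P: "P \<in> t_Spec F A" and S: "finite S" "S \<subseteq> P" and c: "c \<in> P" "c \<noteq> \<zero>"
  obtains t where "t \<in> carrier F" "t \<notin> localization_at F A P"
    "\<And>Q. Q \<in> t_Spec F A \<Longrightarrow> \<not> S \<subseteq> Q \<Longrightarrow> t \<in> localization_at F A Q"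
    "\<And>W g. subring W F \<Longrightarrow> A \<subseteq> W \<Longrightarrow> g \<in> insert c S \<Longrightarrow> g \<noteq> \<zero> \<Longrightarrow> inv g \<in> W \<Longrightarrow> t \<in> W"
proof -
  \<comment> \<open>The extra \<open>c\<close> keeps the generated ideal nonzero and lets an element
    invertible in a prescribed \<open>W\<close> take part.\<close>
  let ?G = "insert c S"
  have GP: "?G \<subseteq> P" using S c by blast
  have GA: "?G \<subseteq> A" using GP t_SpecD(1)[OF P] by blast
  obtain T where T: "T \<subseteq> colon F A ?G"
    "\<And>P. P \<in> t_Spec F A \<Longrightarrow> \<exists>g\<in>?G. \<exists>t\<in>T. g \<otimes> t \<notin> P"
  proof (rule finite_t_inverse)
    show "finite ?G" "?G \<subseteq> A" "\<not> ?G \<subseteq> {\<zero>}" using S(1) GA c(2) by simp_all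
  qed (rule that)
  obtain g t where gt: "g \<in> ?G" "t \<in> T" "g \<otimes> t \<notin> P" using T(2)[OF P] by blast
  have tc: "t \<in> colon F A ?G" using T(1) gt(2) by blast
  then have t: "t \<in> carrier F" "\<And>x. x \<in> ?G \<Longrightarrow> x \<otimes> t \<in> A"
    using GA by (auto simp: colon_iff m_comm subset_iff)
  show ?thesis
  proof (rule that[OF t(1)])
    \<comment> \<open>As \<open>g\<close> is in \<open>P\<close>, having \<open>t\<close> in
      \<open>A\<^sub>P\<close> would force \<open>g t\<close> into \<open>P\<close>.\<close>
    show "t \<notin> localization_at F A P"
      using prime_mult_localization[OF t_Spec_prime[OF P], of g t] gt GP t by blast
    show "t \<in> localization_at F A Q" if "Q \<in> t_Spec F A" "\<not> S \<subseteq> Q" for Q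
      using in_localization_if_colon[OF t_Spec_prime[OF that(1)] GA tc] that(2) by blast
    fix W h assume W: "subring W F" "A \<subseteq> W" "h \<in> ?G" "h \<noteq> \<zero>" "inv h \<in> W"
    have hA: "h \<in> A" using W(3) GA by blast
    have "inv h \<otimes> (h \<otimes> t) \<in> W" using subringE(6)[OF W(1,5)] t(2)[OF W(3)] W(2) by blast
    then show "t \<in> W" using hA W(4) t(1) by simp
  qed
qed

section \<open>Irredundance from the Noetherian condition\<close>

text \<open>The hypothesis controls only the \<open>t\<close>-maximal ideals above \<open>P\<close>.
  But a \<open>t\<close>-prime \<open>Q\<close> containing \<open>S\<close> lies in some
  \<open>t\<close>-maximal \<open>M\<close>, which then contains \<open>P\<close>, and the valuation
  property at \<open>M\<close> makes \<open>P\<close> and \<open>Q\<close> comparable.\<close>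

lemma strongly_irredundant_if_noetherian:
  assumes noeth: "noetherian_space (subtopology (zariski_topology R) (t_Max F A))"
    and Y: "essential_antichain Y" and V: "V \<in> Y"
  shows "strongly_irredundant F A (\<Inter>Y) Y V"
proof -
  obtain P where P: "P \<in> t_Spec F A" "V = localization_at F A P" "V \<subset> carrier F"
    and others: "\<And>W. W \<in> Y - {V} \<Longrightarrow>
      \<exists>Q\<in>t_Spec F A. W = localization_at F A Q \<and> \<not> P \<subseteq> Q \<and> \<not> Q \<subseteq> P"
    using essential_antichainE[OF Y V] by metis
  have "t_Max F A \<subseteq> prime_spectrum R"
    using t_Max_prime t_Spec_prime by (auto simp: prime_spectrum_def)
  moreover have "P \<subseteq> carrier R" using t_SpecD(1)[OF P(1)] by auto
  ultimately obtain S where S: "finite S" "S \<subseteq> P" "\<And>M. M \<in> t_Max F A \<Longrightarrow> S \<subseteq> M \<Longrightarrow> P \<subseteq> M"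
    using noetherian_zariski_finite_subset[OF _ noeth] by metis
  have S_out: "\<not> S \<subseteq> Q" if Q: "Q \<in> t_Spec F A" "\<not> P \<subseteq> Q" "\<not> Q \<subseteq> P" for Q
  proof
    assume "S \<subseteq> Q"
    obtain M where M: "M \<in> t_Max F A" "Q \<subseteq> M" using t_ideal_below_t_Max t_SpecD(4,5)[OF Q(1)] by metis
    then have "P \<subseteq> M" using S(3) \<open>S \<subseteq> Q\<close> by blast
    then show False using t_Spec_comparable[OF t_Max_prime[OF M(1)] P(1) _ Q(1) M(2)] Q by blast
  qed
  have no_larger: "\<not> representation F A (\<Inter>Y) ((Y - {V}) \<union> {W})"
    if W: "valuation_ring F W" "V \<subset> W" for W
  proof
    assume rep: "representation F A (\<Inter>Y) ((Y - {V}) \<union> {W})"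
    have sW: "subring W F" using W(1) by (simp add: valuation_ring_def)
    \<comment> \<open>For a single \<open>W\<close> the separating element may be built with a
      \<open>c\<close> chosen to be a unit of \<open>W\<close>.\<close>
    obtain c where c: "c \<in> P" "c \<noteq> \<zero>" "inv c \<in> W"
      using proper_valuation_overring_inverse[OF t_Spec_prime[OF P(1)] valuation_localization[OF P(1)] sW]
        W(2) P(2) by metis
    obtain t where t: "t \<in> carrier F" "t \<notin> localization_at F A P"
      "\<And>Q. Q \<in> t_Spec F A \<Longrightarrow> \<not> S \<subseteq> Q \<Longrightarrow> t \<in> localization_at F A Q"
      "\<And>W g. subring W F \<Longrightarrow> A \<subseteq> W \<Longrightarrow> g \<in> insert c S \<Longrightarrow> g \<noteq> \<zero> \<Longrightarrow> inv g \<in> W \<Longrightarrow> t \<in> W"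
      using separating_element[OF P(1) S(1,2) c(1,2)] by metis
    have "A \<subseteq> W" using subset_localization[OF t_Spec_prime[OF P(1)]] P(2) W(2) by blast
    then have "t \<in> W" using t(4)[OF sW _ _ c(2,3)] by blast
    moreover have "t \<in> U" if "U \<in> Y - {V}" for U
      using others[OF that] S_out t(3) by blast
    ultimately have "t \<in> carrier F \<inter> \<Inter>((Y - {V}) \<union> {W})" using t(1) by blast
    then have "t \<in> \<Inter>Y" using rep unfolding representation_def by metis
    then show False using V P(2) t(2) by blast
  qed
  \<comment> \<open>Adjoining \<open>F\<close> leaves the intersection unchanged, so irredundance is
    the case of replacing \<open>V\<close> by \<open>F\<close>.\<close>
  have "\<not> representation F A (\<Inter>Y) (Y - {V})"
  proof
    assume rep: "representation F A (\<Inter>Y) (Y - {V})"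
    then have "valuation_ring F W \<and> \<Inter>Y \<subseteq> W" if "W \<in> Y - {V} \<union> {carrier F}" for W
      using that valuation_ring_carrier unfolding representation_def by blast
    then have "representation F A (\<Inter>Y) (Y - {V} \<union> {carrier F})"
      by (rule representation_insert[OF rep Un_upper1])
    then show False using no_larger[OF valuation_ring_carrier P(3)] by simp
  qed
  then show ?thesis using no_larger unfolding strongly_irredundant_def irredundant_def by blast
qed

text \<open>One \<open>t\<close> must now lie in all larger \<open>W\<close> at once, so it cannot
  depend on \<open>W\<close>. Each center is a \<open>t\<close>-prime strictly below
  \<open>P\<close>, and since \<open>S\<close> cuts out \<open>P\<close> among all
  \<open>t\<close>-primes, some element of \<open>S\<close> is outside the center and thus inverted
  in \<open>W\<close>.\<close>

lemma tightly_irredundant_if_noetherian: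
  assumes noeth: "noetherian_space (subtopology (zariski_topology R) (t_Spec F A))"
    and Y: "essential_antichain Y" and V: "V \<in> Y"
  shows "tightly_irredundant F A (\<Inter>Y) Y V"
  unfolding tightly_irredundant_def
proof
  let ?Z = "(Y \<union> {W. valuation_ring F W \<and> V \<subseteq> W}) - {V}"
  assume rep: "representation F A (\<Inter>Y) ?Z"
  obtain P where P: "P \<in> t_Spec F A" "V = localization_at F A P" "V \<subset> carrier F"
    and others: "\<And>W. W \<in> Y - {V} \<Longrightarrow>
      \<exists>Q\<in>t_Spec F A. W = localization_at F A Q \<and> \<not> P \<subseteq> Q \<and> \<not> Q \<subseteq> P"
    using essential_antichainE[OF Y V] by metis
  note pP = t_Spec_prime[OF P(1)] and vP = valuation_localization[OF P(1)]
  have "t_Spec F A \<subseteq> prime_spectrum R"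
    using t_Spec_prime by (auto simp: prime_spectrum_def)
  moreover have "P \<subseteq> carrier R" using t_SpecD(1)[OF P(1)] by auto
  ultimately obtain S where S: "finite S" "S \<subseteq> P" "\<And>M. M \<in> t_Spec F A \<Longrightarrow> S \<subseteq> M \<Longrightarrow> P \<subseteq> M"
    using noetherian_zariski_finite_subset[OF _ noeth] by metis
  \<comment> \<open>Because \<open>V\<close> is not \<open>F\<close>, the prime \<open>P\<close> has
    a nonzero element, which \<open>separating_element\<close> asks for.\<close>
  obtain c0 where c0: "c0 \<in> P" "c0 \<noteq> \<zero>"
    using proper_valuation_overring_inverse[OF pP vP carrier_is_subring] P(2,3) by metis
  obtain t where t: "t \<in> carrier F" "t \<notin> localization_at F A P"
    "\<And>Q. Q \<in> t_Spec F A \<Longrightarrow> \<not> S \<subseteq> Q \<Longrightarrow> t \<in> localization_at F A Q"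
    "\<And>W g. subring W F \<Longrightarrow> A \<subseteq> W \<Longrightarrow> g \<in> insert c0 S \<Longrightarrow> g \<noteq> \<zero> \<Longrightarrow> inv g \<in> W \<Longrightarrow> t \<in> W"
    using separating_element[OF P(1) S(1,2) c0] by metis
  have "t \<in> W" if W: "valuation_ring F W" "V \<subset> W" for W
  proof -
    have sW: "subring W F" using W(1) by (simp add: valuation_ring_def)
    \<comment> \<open>This \<open>c\<close> serves to show that the center \<open>?Q\<close> does
      not contain \<open>P\<close>.\<close>
    obtain c where c: "c \<in> P" "c \<noteq> \<zero>" "inv c \<in> W"
      using proper_valuation_overring_inverse[OF pP vP sW] W(2) P(2) by metis
    let ?Q = "{a \<in> A. a = \<zero> \<or> inv a \<notin> W}"
    have "localization_at F A P \<subseteq> W" using W(2) P(2) by blast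
    then have Q: "primeideal ?Q R" "?Q \<subseteq> P" using valuation_center_prime[OF pP vP sW] by blast+
    have "c \<notin> ?Q" using c by blast
    then have "\<not> P \<subseteq> ?Q" using c(1) by blast
    then have "\<not> S \<subseteq> ?Q" using S(3) t_Spec_downward_closed[OF P(1) Q] by blast
    then obtain g where g: "g \<in> S" "g \<notin> ?Q" by blast
    then have "g \<in> A" using S(2) t_SpecD(1)[OF P(1)] by blast
    then have "g \<noteq> \<zero>" "inv g \<in> W" using g by auto
    moreover have "A \<subseteq> W" using subset_localization[OF pP] P(2) W(2) by blast
    ultimately show ?thesis using t(4)[OF sW] g(1) by blast
  qed
  moreover have "t \<in> U" if "U \<in> Y - {V}" for U
    using others[OF that] S(3) t(3) by blast
  ultimately have "t \<in> carrier F \<inter> \<Inter>?Z" using t(1) by blast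
  then have "t \<in> \<Inter>Y" using rep unfolding representation_def by metis
  then show False using V P(2) t(2) by blast
qed

section \<open>Failure of irredundance along sequences of \<open>t\<close>-primes\<close>

text \<open>The ring of a limit \<open>Q\<close> contains the intersection of the rings of any tail,
  so it is the redundant member; what remains is to make the collection an antichain.\<close>

lemma redundant_essential_antichain:
  fixes P :: "nat \<Rightarrow> 'a set" and f :: "nat \<Rightarrow> 'a"
  assumes P: "\<And>n. P n \<in> t_Spec F A" and inc: "\<And>m n. m \<noteq> n \<Longrightarrow> \<not> P m \<subseteq> P n"
    and f: "\<And>n. f n \<in> A - P n" "\<And>n m. n < m \<Longrightarrow> f n \<in> P m"
  obtains Y V where "essential_antichain Y" "V \<in> Y" "representation F A (\<Inter>Y) (Y - {V})"
proof -
  obtain Q where Q: "Q \<in> t_Spec F A"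
    "\<And>a N. a \<in> A \<Longrightarrow> (\<And>m. m > N \<Longrightarrow> a \<in> P m) \<Longrightarrow> a \<in> Q"
    "\<And>S. finite S \<Longrightarrow> S \<subseteq> Q \<Longrightarrow> infinite {m. S \<subseteq> P m}"
    using t_prime_limit[of P] P by metis
  \<comment> \<open>The element \<open>f n\<close> is in every later \<open>P m\<close>, hence in
    \<open>Q\<close>, but not in \<open>P n\<close>.\<close>
  have QP: "\<not> Q \<subseteq> P n" for n using Q(2)[of "f n" n] f by blast
  have unique: "m = n" if "P m \<subseteq> Q" "P n \<subseteq> Q" for m n
    using t_Spec_comparable[OF Q(1) P _ P] that inc by metis
  \<comment> \<open>By \<open>unique\<close> at most one \<open>P n\<close> lies inside
    \<open>Q\<close>, so a tail past that index suffices.\<close>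
  obtain k where k: "\<And>n. n \<ge> k \<Longrightarrow> \<not> P n \<subseteq> Q"
    using unique by (metis Suc_n_not_le_n)
  let ?L = "localization_at F A"
  let ?Y = "insert (?L Q) ((\<lambda>n. ?L (P n)) ` {k..})"
  have pair: "pairwise (\<lambda>V W. \<not> V \<subseteq> W) ?Y"
  proof (rule pairwiseI)
    fix V W assume VW: "V \<in> ?Y" "W \<in> ?Y" "V \<noteq> W"
    have 1: "\<not> ?L Q \<subseteq> ?L (P n)" if "n \<ge> k" for n
      using localization_le_iff[OF Q(1) P] k[OF that] by simp
    have 2: "\<not> ?L (P n) \<subseteq> ?L Q" for n
      using localization_le_iff[OF P Q(1)] QP by simp
    have 3: "\<not> ?L (P m) \<subseteq> ?L (P n)" if "m \<noteq> n" for m n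
      using localization_le_iff[OF P P] inc that by simp
    show "\<not> V \<subseteq> W" using VW 1 2 3 by (elim insertE imageE) (simp, simp, simp, metis)
  qed
  have ne: "?L (P k) \<noteq> ?L Q" using localization_le_iff[OF P Q(1), of k] QP[of k] by auto
  have "?Y \<noteq> {carrier F}"
  proof
    assume "?Y = {carrier F}"
    then have "?L Q = carrier F" "?L (P k) = carrier F" by auto
    then show False using ne by simp
  qed
  moreover have "essential_valuation_overring F A V" if "V \<in> ?Y" for V
    using that P Q(1) by (auto simp: essential_valuation_overring_iff)
  ultimately have Y: "essential_antichain ?Y" using pair by blast
  have "\<Inter>(?Y - {?L Q}) \<subseteq> ?L Q"
  proof
    fix x assume x: "x \<in> \<Inter>(?Y - {?L Q})"
    have "x \<in> ?L (P n)" if "n \<ge> k" for n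
    proof -
      have "?L (P n) \<noteq> ?L Q" using localization_le_iff[OF P Q(1), of n] QP[of n] by auto
      then show ?thesis using x that by blast
    qed
    moreover have "x \<in> carrier F"
      using calculation[of k] subringE(1)[OF subring_localization[OF t_Spec_prime[OF P]]] by blast
    ultimately show "x \<in> ?L Q" using localization_limit[OF Q(1) P Q(3)] by blast
  qed
  then show ?thesis
    using that[OF Y] representation_remove[OF representation_essential_antichain[OF Y]] by blast
qed

text \<open>The ring of each \<open>P n\<close> is strictly larger than that of the limit
  \<open>Q\<close>, yet these rings intersect inside it; so the ring of \<open>Q\<close> is an
  intersection of strictly larger valuation rings.\<close>

lemma not_tightly_irredundant_chain:
  fixes P :: "nat \<Rightarrow> 'a set"
  assumes P: "\<And>n. P n \<in> t_Spec F A" and inc: "\<And>m n. m < n \<Longrightarrow> P m \<subset> P n"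
  obtains Y V where "essential_antichain Y" "V \<in> Y" "\<not> tightly_irredundant F A (\<Inter>Y) Y V"
proof -
  obtain Q where Q: "Q \<in> t_Spec F A"
    "\<And>a N. a \<in> A \<Longrightarrow> (\<And>m. m > N \<Longrightarrow> a \<in> P m) \<Longrightarrow> a \<in> Q"
    "\<And>S. finite S \<Longrightarrow> S \<subseteq> Q \<Longrightarrow> infinite {m. S \<subseteq> P m}"
    using t_prime_limit[of P] P by metis
  let ?L = "localization_at F A"
  have sub: "P n \<subseteq> Q" for n
  proof
    fix a assume a: "a \<in> P n"
    then show "a \<in> Q" using Q(2)[of a n] t_SpecD(1)[OF P] inc by blast
  qed
  have psub: "P n \<subset> Q" for n using sub[of "Suc n"] inc[of n "Suc n"] by auto
  have larger: "?L Q \<subset> ?L (P n)" for n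
    using localization_le_iff[OF Q(1) P] localization_le_iff[OF P Q(1)] psub[of n] by blast
  have carr: "?L (P n) \<subseteq> carrier F" for n
    using subringE(1)[OF subring_localization[OF t_Spec_prime[OF P]]] .
  have "essential_valuation_overring F A (?L Q)" using Q(1) by (auto simp: essential_valuation_overring_iff)
  moreover have "?L Q \<noteq> carrier F" using larger carr by blast
  ultimately have Y: "essential_antichain {?L Q}" by (simp add: pairwise_def)
  let ?Z = "({?L Q} \<union> {W. valuation_ring F W \<and> ?L Q \<subseteq> W}) - {?L Q}"
  have Z: "\<Inter>?Z \<subseteq> ?L Q"
  proof
    fix x assume x: "x \<in> \<Inter>?Z"
    have "x \<in> ?L (P n)" for n
      using x larger[of n] valuation_localization[OF P] by blast
    moreover have "x \<in> carrier F" using calculation[of 0] carr by blast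
    ultimately show "x \<in> ?L Q" using localization_limit[OF Q(1) P Q(3)] by blast
  qed
  have "representation F A (?L Q) {?L Q}" using representation_essential_antichain[OF Y] by simp
  then have "subring (?L Q) F \<and> A \<subseteq> ?L Q \<and> ?L Q \<subset> carrier F" by (simp add: representation_def)
  moreover have "?L Q = carrier F \<inter> \<Inter>?Z" using Z calculation by blast
  ultimately have "representation F A (\<Inter>{?L Q}) ?Z" unfolding representation_def by auto
  then show ?thesis using that[OF Y] unfolding tightly_irredundant_def by blast
qed

section \<open>The two equivalences\<close>

lemma noetherian_t_Max_iff:
  "noetherian_space (subtopology (zariski_topology R) (t_Max F A)) \<longleftrightarrow>
    (\<forall>Y. essential_antichain Y \<longrightarrow> strongly_irredundant_representation F A (\<Inter>Y) Y)"
proof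
  assume "noetherian_space (subtopology (zariski_topology R) (t_Max F A))"
  then show "\<forall>Y. essential_antichain Y \<longrightarrow> strongly_irredundant_representation F A (\<Inter>Y) Y"
    unfolding strongly_irredundant_representation_def
    using strongly_irredundant_if_noetherian representation_essential_antichain by simp
next
  assume strong: "\<forall>Y. essential_antichain Y \<longrightarrow> strongly_irredundant_representation F A (\<Inter>Y) Y"
  have sp: "t_Max F A \<subseteq> prime_spectrum R"
    using t_Max_prime t_Spec_prime by (auto simp: prime_spectrum_def)
  show "noetherian_space (subtopology (zariski_topology R) (t_Max F A))"
    unfolding noetherian_zariski_subspace_iff[OF sp]
  proof
    assume "\<exists>P f. (\<forall>n::nat. P n \<in> t_Max F A \<and> f n \<in> carrier R - P n) \<and> (\<forall>n m. n < m \<longrightarrow> f n \<in> P m)"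
    then obtain P f where P: "\<And>n::nat. P n \<in> t_Max F A" and f: "\<And>n. f n \<in> A - P n" "\<And>n m. n < m \<Longrightarrow> f n \<in> P m"
      by auto
    \<comment> \<open>The \<open>f n\<close> keep the points distinct, and distinct
      \<open>t\<close>-maximal ideals are incomparable.\<close>
    have ne: "P m \<noteq> P n" if "m < n" for m n
      using f(1)[of m] f(2)[OF that] by auto
    have "\<not> P m \<subseteq> P n" if "m \<noteq> n" for m n
    proof
      assume "P m \<subseteq> P n"
      then have "P n = P m" using P[of m] P[of n] by (simp add: t_Max_def)
      then show False using ne[of m n] ne[of n m] that by (cases m n rule: linorder_cases) auto
    qed
    then obtain Y V where "essential_antichain Y" "V \<in> Y" "representation F A (\<Inter>Y) (Y - {V})"
      using redundant_essential_antichain[of P f] t_Max_prime[OF P] f by metis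
    then show False
      using strong unfolding strongly_irredundant_representation_def strongly_irredundant_def irredundant_def
      by blast
  qed
qed

lemma noetherian_t_Spec_iff:
  "noetherian_space (subtopology (zariski_topology R) (t_Spec F A)) \<longleftrightarrow>
    (\<forall>Y. essential_antichain Y \<longrightarrow> tightly_irredundant_representation F A (\<Inter>Y) Y)"
proof
  assume "noetherian_space (subtopology (zariski_topology R) (t_Spec F A))"
  then show "\<forall>Y. essential_antichain Y \<longrightarrow> tightly_irredundant_representation F A (\<Inter>Y) Y"
    unfolding tightly_irredundant_representation_def
    using tightly_irredundant_if_noetherian representation_essential_antichain by simp
next
  assume tight: "\<forall>Y. essential_antichain Y \<longrightarrow> tightly_irredundant_representation F A (\<Inter>Y) Y"
  have sp: "t_Spec F A \<subseteq> prime_spectrum R"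
    using t_Spec_prime by (auto simp: prime_spectrum_def)
  show "noetherian_space (subtopology (zariski_topology R) (t_Spec F A))"
    unfolding noetherian_zariski_subspace_iff[OF sp]
  proof
    assume "\<exists>P f. (\<forall>n::nat. P n \<in> t_Spec F A \<and> f n \<in> carrier R - P n) \<and> (\<forall>n m. n < m \<longrightarrow> f n \<in> P m)"
    then obtain P f where P: "\<And>n::nat. P n \<in> t_Spec F A" and f: "\<And>n. f n \<in> A - P n" "\<And>n m. n < m \<Longrightarrow> f n \<in> P m"
      by auto
    \<comment> \<open>The \<open>f n\<close> exclude inclusions of later points in earlier ones, so
      each pair is either ascending or incomparable and two colors suffice.\<close>
    have down: "\<not> P n \<subseteq> P m" if "m < n" for m n using f(1)[of m] f(2)[OF that] by blast
    txt \<open>By Ramsey's theorem the sequence contains an infinite ascending chain or an infinite antichain.\<close>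
    define color where "color B = (if P (Min B) \<subseteq> P (Max B) then 0 else 1::nat)" for B
    have "\<forall>x\<in>UNIV. \<forall>y\<in>UNIV. x \<noteq> y \<longrightarrow> color {x, y} < 2" by (simp add: color_def)
    from Ramsey2[OF infinite_UNIV_nat this] obtain Z t where Z: "infinite Z"
      "\<forall>x\<in>Z. \<forall>y\<in>Z. x \<noteq> y \<longrightarrow> color {x, y} = t" by (elim exE conjE) (rule that)
    define e where "e = enumerate Z"
    have e: "e m < e n" "e n \<in> Z" if "m < n" for m n
      unfolding e_def using enumerate_mono[OF that Z(1)] enumerate_in_set[OF Z(1)] by auto
    have eZ: "e n \<in> Z" for n unfolding e_def by (rule enumerate_in_set[OF Z(1)])
    \<comment> \<open>\<open>Min\<close> and \<open>Max\<close> of the unordered pair restore the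
      order of the indices.\<close>
    have col: "t = (if P (e m) \<subseteq> P (e n) then 0 else 1)" if "m < n" for m n
      using Z(2)[rule_format, OF eZ[of m] eZ[of n]] e(1)[OF that] by (simp add: color_def)
    show False
    proof (cases "t = 0")
      case True
      then have "P (e m) \<subset> P (e n)" if "m < n" for m n
        using col[OF that] down[OF e(1)[OF that]] by (auto split: if_splits)
      then obtain Y V where "essential_antichain Y" "V \<in> Y" "\<not> tightly_irredundant F A (\<Inter>Y) Y V"
        using not_tightly_irredundant_chain[of "\<lambda>n. P (e n)"] P by metis
      then show False using tight unfolding tightly_irredundant_representation_def by blast
    next
      case False
      then have up: "\<not> P (e m) \<subseteq> P (e n)" if "m < n" for m n using col[OF that] by auto
      have "\<not> P (e m) \<subseteq> P (e n)" if "m \<noteq> n" for m n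
        using that up down[OF e(1)] by (metis linorder_neqE_nat)
      moreover have "f (e n) \<in> P (e m)" if "n < m" for n m using f(2) e(1)[OF that] by simp
      ultimately obtain Y V where Y: "essential_antichain Y" "V \<in> Y" and rep: "representation F A (\<Inter>Y) (Y - {V})"
        using redundant_essential_antichain[of "\<lambda>n. P (e n)" "\<lambda>n. f (e n)"] P f(1) by metis
      \<comment> \<open>Redundance of \<open>V\<close> persists when valuation rings above
        \<open>V\<close> are adjoined, which contradicts tight irredundance.\<close>
      let ?Z = "(Y \<union> {W. valuation_ring F W \<and> V \<subseteq> W}) - {V}"
      have "valuation_ring F W \<and> \<Inter>Y \<subseteq> W" if "W \<in> ?Z" for W
        using that rep Y(2) unfolding representation_def by blast
      then have "representation F A (\<Inter>Y) ?Z"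
        by (rule representation_insert[OF rep Diff_mono[OF Un_upper1 order_refl]])
      then show False
        using tight Y unfolding tightly_irredundant_representation_def tightly_irredundant_def by blast
    qed
  qed
qed

end

theorem theorem6p9:
  fixes F :: "('a, 'b) ring_scheme" and A :: "'a set"
  assumes "quotient_field F A"
    and "carrier F \<noteq> A"
    and "PvMD F A"
  shows "(noetherian_space (subtopology (zariski_topology (subring_of F A)) (t_Max F A)) \<longleftrightarrow>
            (\<forall>Y. Y \<noteq> {} \<and> Y \<noteq> {carrier F} \<and>
               (\<forall>V\<in>Y. essential_valuation_overring F A V) \<and>
               pairwise (\<lambda>V W. \<not> V \<subseteq> W) Y \<longrightarrow>
               strongly_irredundant_representation F A (\<Inter>Y) Y)) \<and>
         (noetherian_space (subtopology (zariski_topology (subring_of F A)) (t_Spec F A)) \<longleftrightarrow>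
            (\<forall>Y. Y \<noteq> {} \<and> Y \<noteq> {carrier F} \<and>
               (\<forall>V\<in>Y. essential_valuation_overring F A V) \<and>
               pairwise (\<lambda>V W. \<not> V \<subseteq> W) Y \<longrightarrow>
               tightly_irredundant_representation F A (\<Inter>Y) Y))"
proof -
  have "Pruefer_v_multiplication_domain F A"
    by unfold_locales (fact assms)+
  then show ?thesis
    using Pruefer_v_multiplication_domain.noetherian_t_Max_iff
      Pruefer_v_multiplication_domain.noetherian_t_Spec_iff by (intro conjI)
qed

end
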